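(* Let $\varepsilon\in\{1,-1\}$ and let $M$ be an $n$-dimensional submanifold of codimension $r$ in a Riemannian manifold $(\widetilde M,\widetilde g)$ equipped with a $(1,1)$-tensor field $\widetilde P$ such that $\widetilde P^2=\varepsilon I$ and $\widetilde g(\widetilde PU,\widetilde PV)=\widetilde g(U,V)$ for all vector fields $U,V$ on $\widetilde M$. If $\widetilde P$ is parallel with respect to the Levi-Civita connection $\widetilde\nabla$ of $\widetilde g$, then the induced structure $(P,g,u_\alpha,\varepsilon\xi_\alpha,(a_{\alpha\beta})_r)$ on $M$ satisfies, for all $X,Y\in\chi(M)$ and all $\alpha,\beta\in\{1,\dots,r\}$: (i) $(\nabla_XP)(Y)=\varepsilon\sum_\alpha h_\alpha(X,Y)\xi_\alpha+\sum_\alpha u_\alpha(Y)A_\alpha X$; (ii) $(\nabla_Xu_\alpha)(Y)=-h_\alpha(X,PY)+\sum_\beta u_\beta(Y)l_{\alpha\beta}(X)+\sum_\beta h_\beta(X,Y)a_{\beta\alpha}$; (iii) $\nabla_X\xi_\alpha=-\varepsilon P(A_\alpha X)+\varepsilon\sum_\beta a_{\alpha\beta}A_\beta X+\sum_\beta l_{\alpha\beta}(X)\xi_\beta$; (iv) $X(a_{\alpha\beta})=-\varepsilon u_\alpha(A_\beta X)-u_\beta(A_\alpha X)+\sum_\gamma\bigl[l_{\alpha\gamma}(X)a_{\gamma\beta}+l_{\beta\gamma}(X)a_{\alpha\gamma}\bigr]$.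
   Context: $g$ is the metric induced on $M$, $\nabla$ its Levi-Civita connection, $\chi(M)$ the vector fields on $M$, and $(N_1,\dots,N_r)$ a smooth orthonormal frame of the normal bundle of $M$. The induced structure is defined by the decompositions into components tangent and normal to $M$: $$\widetilde P X=PX+\sum_{\alpha}u_\alpha(X)N_\alpha\ (X\in\chi(M)),\qquad \widetilde P N_\alpha=\varepsilon\xi_\alpha+\sum_\beta a_{\alpha\beta}N_\beta,$$ where $P$ is a $(1,1)$-tensor field, $u_\alpha$ are 1-forms, $\xi_\alpha$ are tangent vector fields and $a_{\alpha\beta}$ are real functions on $M$. The second fundamental forms $h_\alpha$, Weingarten operators $A_\alpha$ and normal connection forms $l_{\alpha\beta}$ are defined by $$\widetilde\nabla_XY=\nabla_XY+\sum_\alpha h_\alpha(X,Y)N_\alpha,\quad \widetilde\nabla_XN_\alpha=-A_\alpha X+\nabla^\bot_XN_\alpha,\quad \nabla^\bot_XN_\alpha=\sum_\beta l_{\alpha\beta}(X)N_\beta,$$ so that $h_\alpha(X,Y)=g(A_\alpha X,Y)$ and $l_{\alpha\beta}=-l_{\beta\alpha}$. *)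

theory Defs
  imports "HOL-Analysis.Analysis"
begin

text \<open>The library has no smooth manifolds, so this theory sets up what is needed of them.
  A manifold is a set of points of an arbitrary type (the topspace of an abstract topology) with a
  smooth atlas modelled on a Euclidean space; its dimension is the \<open>DIM\<close> of the model type.\<close>

section \<open>Smooth maps between Euclidean spaces\<close>

text \<open>Only used for open \<open>S\<close>.  The second clause says that \<open>f\<close> is differentiable on \<open>S\<close>
  and that all its directional derivatives are \<open>k\<close> times continuously differentiable.\<close>

primrec Ck_on :: "nat \<Rightarrow> 'e::real_normed_vector set \<Rightarrow> ('e \<Rightarrow> 'g::real_normed_vector) \<Rightarrow> bool" where
  "Ck_on 0 S f \<longleftrightarrow> continuous_on S f"
| "Ck_on (Suc k) S f \<longleftrightarrow>
     (\<forall>x\<in>S. f differentiable (at x)) \<and> (\<forall>v. Ck_on k S (\<lambda>x. frechet_derivative f (at x) v))"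

definition smooth_on :: "'e::real_normed_vector set \<Rightarrow> ('e \<Rightarrow> 'g::real_normed_vector) \<Rightarrow> bool" where
  "smooth_on S f \<longleftrightarrow> (\<forall>k. Ck_on k S f)"

section \<open>Smooth manifolds and smooth maps\<close>

text \<open>A chart is a pair of a domain and a coordinate map; the coordinate map is irrelevant outside
  the domain.\<close>

type_synonym ('a, 'e) chart = "'a set \<times> ('a \<Rightarrow> 'e)"

abbreviation dom_of :: "('a, 'e) chart \<Rightarrow> 'a set" where "dom_of \<equiv> fst"
abbreviation map_of_chart :: "('a, 'e) chart \<Rightarrow> 'a \<Rightarrow> 'e" where "map_of_chart \<equiv> snd"

definition inv_chart :: "('a, 'e) chart \<Rightarrow> 'e \<Rightarrow> 'a" where
  "inv_chart c = inv_into (dom_of c) (map_of_chart c)"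

record ('a, 'e) manifold =
  topology_of :: "'a topology"
  atlas :: "('a, 'e) chart set"

abbreviation points :: "('a, 'e) manifold \<Rightarrow> 'a set" where
  "points M \<equiv> topspace (topology_of M)"

abbreviation open_in :: "('a, 'e) manifold \<Rightarrow> 'a set \<Rightarrow> bool" where
  "open_in M \<equiv> openin (topology_of M)"

definition smooth_manifold :: "('a, 'e::euclidean_space) manifold \<Rightarrow> bool" where
  "smooth_manifold M \<longleftrightarrow>
     Hausdorff_space (topology_of M) \<and> second_countable (topology_of M) \<and>
     (\<Union>c\<in>atlas M. dom_of c) = points M \<and>
     (\<forall>c\<in>atlas M. open_in M (dom_of c) \<and> open (map_of_chart c ` dom_of c) \<and>
        homeomorphic_map (subtopology (topology_of M) (dom_of c))
          (top_of_set (map_of_chart c ` dom_of c)) (map_of_chart c)) \<and>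
     (\<forall>c\<in>atlas M. \<forall>d\<in>atlas M.
        smooth_on (map_of_chart c ` (dom_of c \<inter> dom_of d)) (map_of_chart d \<circ> inv_chart c))"

definition smooth_fun_on ::
    "('a, 'e::euclidean_space) manifold \<Rightarrow> 'a set \<Rightarrow> ('a \<Rightarrow> 'g::real_normed_vector) \<Rightarrow> bool" where
  "smooth_fun_on M W f \<longleftrightarrow>
     (\<forall>c\<in>atlas M. smooth_on (map_of_chart c ` (dom_of c \<inter> W)) (f \<circ> inv_chart c))"

definition smooth_map :: "('a, 'e::euclidean_space) manifold \<Rightarrow> ('b, 'f::euclidean_space) manifold
    \<Rightarrow> ('a \<Rightarrow> 'b) \<Rightarrow> bool" where
  "smooth_map M N \<phi> \<longleftrightarrow>
     continuous_map (topology_of M) (topology_of N) \<phi> \<and>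
     (\<forall>d\<in>atlas N. smooth_fun_on M {p \<in> points M. \<phi> p \<in> dom_of d} (map_of_chart d \<circ> \<phi>))"

section \<open>Tangent vectors\<close>

text \<open>A tangent vector at \<open>p\<close> assigns to every chart around \<open>p\<close> its coordinate vector in that
  chart, subject to the transformation law; the type below holds all such assignments, and
  \<open>tangent_space M p\<close> cuts out the tangent vectors at \<open>p\<close>.  Charts of the atlas not
  containing \<open>p\<close>, and pairs that are not charts of the atlas, get the value \<open>0\<close>, so
  that equality of tangent vectors is equality in this type.\<close>

typedef ('a, 'e) tvec = "UNIV :: (('a, 'e) chart \<Rightarrow> 'e) set"
  morphisms coords Tvec ..

setup_lifting type_definition_tvec

instantiation tvec :: (type, real_vector) real_vector
begin

lift_definition zero_tvec :: "('a, 'b) tvec" is "\<lambda>c. 0" .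
lift_definition plus_tvec :: "('a, 'b) tvec \<Rightarrow> ('a, 'b) tvec \<Rightarrow> ('a, 'b) tvec" is
  "\<lambda>v w c. v c + w c" .
lift_definition minus_tvec :: "('a, 'b) tvec \<Rightarrow> ('a, 'b) tvec \<Rightarrow> ('a, 'b) tvec" is
  "\<lambda>v w c. v c - w c" .
lift_definition uminus_tvec :: "('a, 'b) tvec \<Rightarrow> ('a, 'b) tvec" is "\<lambda>v c. - v c" .
lift_definition scaleR_tvec :: "real \<Rightarrow> ('a, 'b) tvec \<Rightarrow> ('a, 'b) tvec" is
  "\<lambda>a v c. a *\<^sub>R v c" .

instance
  by standard (transfer; simp add: fun_eq_iff algebra_simps)+

end

definition tangent_space :: "('a, 'e::euclidean_space) manifold \<Rightarrow> 'a \<Rightarrow> ('a, 'e) tvec set" where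
  "tangent_space M p = {v.
     (\<forall>c\<in>atlas M. \<forall>d\<in>atlas M. p \<in> dom_of c \<longrightarrow> p \<in> dom_of d \<longrightarrow>
        coords v d = frechet_derivative (map_of_chart d \<circ> inv_chart c) (at (map_of_chart c p)) (coords v c)) \<and>
     (\<forall>c. \<not> (c \<in> atlas M \<and> p \<in> dom_of c) \<longrightarrow> coords v c = 0)}"

definition chart_at :: "('a, 'e) manifold \<Rightarrow> 'a \<Rightarrow> ('a, 'e) chart" where
  "chart_at M p = (SOME c. c \<in> atlas M \<and> p \<in> dom_of c)"

text \<open>The derivative \<open>v(f)\<close> of a function \<open>f\<close> along \<open>v \<in> T\<^sub>pM\<close>, computed in
  some chart around \<open>p\<close>; by the transformation law the choice is immaterial.\<close>

definition vderiv :: "('a, 'e::euclidean_space) manifold \<Rightarrow> 'a \<Rightarrow> ('a, 'e) tvec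
    \<Rightarrow> ('a \<Rightarrow> 'g::real_normed_vector) \<Rightarrow> 'g" where
  "vderiv M p v f =
     frechet_derivative (f \<circ> inv_chart (chart_at M p)) (at (map_of_chart (chart_at M p) p))
       (coords v (chart_at M p))"

definition pushforward :: "('a, 'e::euclidean_space) manifold \<Rightarrow> ('b, 'f::euclidean_space) manifold
    \<Rightarrow> ('a \<Rightarrow> 'b) \<Rightarrow> 'a \<Rightarrow> ('a, 'e) tvec \<Rightarrow> ('b, 'f) tvec" where
  "pushforward M N \<phi> p v = Tvec (\<lambda>d.
     if d \<in> atlas N \<and> \<phi> p \<in> dom_of d then vderiv M p v (map_of_chart d \<circ> \<phi>) else 0)"

definition immersion :: "('a, 'e::euclidean_space) manifold \<Rightarrow> ('b, 'f::euclidean_space) manifold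
    \<Rightarrow> ('a \<Rightarrow> 'b) \<Rightarrow> bool" where
  "immersion M N \<phi> \<longleftrightarrow> smooth_map M N \<phi> \<and>
     (\<forall>p\<in>points M. inj_on (pushforward M N \<phi> p) (tangent_space M p))"

section \<open>Vector fields and tensor fields\<close>

text \<open>Smooth vector fields along \<open>\<phi>\<close> over the open set \<open>W\<close>, i.e. sections over \<open>W\<close>
  of the pull-back of the tangent bundle of \<open>N\<close>.  Values outside \<open>W\<close> are irrelevant.\<close>

definition vfields_along :: "('a, 'e::euclidean_space) manifold \<Rightarrow> ('b, 'f::euclidean_space) manifold
    \<Rightarrow> ('a \<Rightarrow> 'b) \<Rightarrow> 'a set \<Rightarrow> ('a \<Rightarrow> ('b, 'f) tvec) set" where
  "vfields_along M N \<phi> W = {V.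
     (\<forall>p\<in>W. V p \<in> tangent_space N (\<phi> p)) \<and>
     (\<forall>d\<in>atlas N. smooth_fun_on M {p \<in> W. \<phi> p \<in> dom_of d} (\<lambda>p. coords (V p) d))}"

abbreviation vfields_on ::
    "('a, 'e::euclidean_space) manifold \<Rightarrow> 'a set \<Rightarrow> ('a \<Rightarrow> ('a, 'e) tvec) set" where
  "vfields_on M W \<equiv> vfields_along M M (\<lambda>p. p) W"

abbreviation vfields :: "('a, 'e::euclidean_space) manifold \<Rightarrow> ('a \<Rightarrow> ('a, 'e) tvec) set" where
  "vfields M \<equiv> vfields_on M (points M)"

definition lie_bracket :: "('a, 'e::euclidean_space) manifold \<Rightarrow> ('a \<Rightarrow> ('a, 'e) tvec)
    \<Rightarrow> ('a \<Rightarrow> ('a, 'e) tvec) \<Rightarrow> 'a \<Rightarrow> ('a, 'e) tvec" where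
  "lie_bracket M X Y p = Tvec (\<lambda>c. if c \<in> atlas M \<and> p \<in> dom_of c then
     vderiv M p (X p) (\<lambda>q. coords (Y q) c) - vderiv M p (Y p) (\<lambda>q. coords (X q) c) else 0)"

definition linear_over :: "'v::real_vector set \<Rightarrow> ('v \<Rightarrow> 'w::real_vector) \<Rightarrow> bool" where
  "linear_over T F \<longleftrightarrow>
     (\<forall>v\<in>T. \<forall>w\<in>T. \<forall>a b. F (a *\<^sub>R v + b *\<^sub>R w) = a *\<^sub>R F v + b *\<^sub>R F w)"

text \<open>Tensor fields are given pointwise; smoothness is tested on the vector fields over arbitrary
  open sets, and in particular on the coordinate fields.\<close>

definition one_form :: "('a, 'e::euclidean_space) manifold
    \<Rightarrow> ('a \<Rightarrow> ('a, 'e) tvec \<Rightarrow> real) \<Rightarrow> bool" where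
  "one_form M u \<longleftrightarrow>
     (\<forall>p\<in>points M. linear_over (tangent_space M p) (u p)) \<and>
     (\<forall>W. open_in M W \<longrightarrow> (\<forall>X\<in>vfields_on M W. smooth_fun_on M W (\<lambda>p. u p (X p))))"

definition tensor02 :: "('a, 'e::euclidean_space) manifold
    \<Rightarrow> ('a \<Rightarrow> ('a, 'e) tvec \<Rightarrow> ('a, 'e) tvec \<Rightarrow> real) \<Rightarrow> bool" where
  "tensor02 M g \<longleftrightarrow>
     (\<forall>p\<in>points M. \<forall>v\<in>tangent_space M p.
        linear_over (tangent_space M p) (g p v) \<and> linear_over (tangent_space M p) (\<lambda>w. g p w v)) \<and>
     (\<forall>W. open_in M W \<longrightarrow>
        (\<forall>X\<in>vfields_on M W. \<forall>Y\<in>vfields_on M W. smooth_fun_on M W (\<lambda>p. g p (X p) (Y p))))"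

definition tensor11 :: "('a, 'e::euclidean_space) manifold
    \<Rightarrow> ('a \<Rightarrow> ('a, 'e) tvec \<Rightarrow> ('a, 'e) tvec) \<Rightarrow> bool" where
  "tensor11 M P \<longleftrightarrow>
     (\<forall>p\<in>points M. P p ` tangent_space M p \<subseteq> tangent_space M p \<and>
        linear_over (tangent_space M p) (P p)) \<and>
     (\<forall>W. open_in M W \<longrightarrow> (\<forall>X\<in>vfields_on M W. (\<lambda>p. P p (X p)) \<in> vfields_on M W))"

definition riemannian_metric :: "('a, 'e::euclidean_space) manifold
    \<Rightarrow> ('a \<Rightarrow> ('a, 'e) tvec \<Rightarrow> ('a, 'e) tvec \<Rightarrow> real) \<Rightarrow> bool" where
  "riemannian_metric M g \<longleftrightarrow> tensor02 M g \<and>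
     (\<forall>p\<in>points M. \<forall>v\<in>tangent_space M p.
        (\<forall>w\<in>tangent_space M p. g p v w = g p w v) \<and> (v \<noteq> 0 \<longrightarrow> g p v v > 0))"

definition pullback_metric :: "('a, 'e::euclidean_space) manifold \<Rightarrow> ('b, 'f::euclidean_space) manifold
    \<Rightarrow> ('a \<Rightarrow> 'b) \<Rightarrow> ('b \<Rightarrow> ('b, 'f) tvec \<Rightarrow> ('b, 'f) tvec \<Rightarrow> real)
    \<Rightarrow> 'a \<Rightarrow> ('a, 'e) tvec \<Rightarrow> ('a, 'e) tvec \<Rightarrow> real" where
  "pullback_metric M N \<phi> g p v w = g (\<phi> p) (pushforward M N \<phi> p v) (pushforward M N \<phi> p w)"

section \<open>The Levi-Civita connection\<close>

text \<open>\<open>D p v Y\<close> is the covariant derivative at \<open>p\<close> of the vector field \<open>Y\<close>, defined on some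
  neighbourhood of \<open>p\<close>, along \<open>v \<in> T\<^sub>pM\<close>.  The second clause says that it depends only on
  \<open>Y\<close> near \<open>p\<close>; it is needed because a field over \<open>W\<close> is a total function with arbitrary
  values outside \<open>W\<close>.\<close>

definition affine_connection :: "('a, 'e::euclidean_space) manifold
    \<Rightarrow> ('a \<Rightarrow> ('a, 'e) tvec \<Rightarrow> ('a \<Rightarrow> ('a, 'e) tvec) \<Rightarrow> ('a, 'e) tvec) \<Rightarrow> bool" where
  "affine_connection M D \<longleftrightarrow> (\<forall>W. open_in M W \<longrightarrow>
     (\<forall>X\<in>vfields_on M W. \<forall>Y\<in>vfields_on M W. (\<lambda>p. D p (X p) Y) \<in> vfields_on M W) \<and>
     (\<forall>Y\<in>vfields_on M W. \<forall>Z\<in>vfields_on M W. \<forall>p\<in>W. \<forall>v\<in>tangent_space M p.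
        (\<forall>q\<in>W. Y q = Z q) \<longrightarrow> D p v Y = D p v Z) \<and>
     (\<forall>Y\<in>vfields_on M W. \<forall>p\<in>W. (\<forall>v\<in>tangent_space M p. D p v Y \<in> tangent_space M p) \<and>
        linear_over (tangent_space M p) (\<lambda>v. D p v Y)) \<and>
     (\<forall>Y\<in>vfields_on M W. \<forall>Z\<in>vfields_on M W. \<forall>p\<in>W. \<forall>v\<in>tangent_space M p.
        D p v (\<lambda>q. Y q + Z q) = D p v Y + D p v Z) \<and>
     (\<forall>Y\<in>vfields_on M W. \<forall>f. smooth_fun_on M W f \<longrightarrow> (\<forall>p\<in>W. \<forall>v\<in>tangent_space M p.
        D p v (\<lambda>q. f q *\<^sub>R Y q) = vderiv M p v f *\<^sub>R Y p + f p *\<^sub>R D p v Y)))"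

definition levi_civita :: "('a, 'e::euclidean_space) manifold
    \<Rightarrow> ('a \<Rightarrow> ('a, 'e) tvec \<Rightarrow> ('a, 'e) tvec \<Rightarrow> real)
    \<Rightarrow> ('a \<Rightarrow> ('a, 'e) tvec \<Rightarrow> ('a \<Rightarrow> ('a, 'e) tvec) \<Rightarrow> ('a, 'e) tvec) \<Rightarrow> bool" where
  "levi_civita M g D \<longleftrightarrow> affine_connection M D \<and> (\<forall>W. open_in M W \<longrightarrow>
     (\<forall>X\<in>vfields_on M W. \<forall>Y\<in>vfields_on M W. \<forall>p\<in>W.
        D p (X p) Y - D p (Y p) X = lie_bracket M X Y p) \<and>
     (\<forall>Y\<in>vfields_on M W. \<forall>Z\<in>vfields_on M W. \<forall>p\<in>W. \<forall>v\<in>tangent_space M p.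
        vderiv M p v (\<lambda>q. g q (Y q) (Z q)) = g p (D p v Y) (Z p) + g p (Y p) (D p v Z)))"

text \<open>\<open>(\<nabla>\<^sub>XP)(Y)\<close> and \<open>(\<nabla>\<^sub>Xu)(Y)\<close> at \<open>p\<close>, for a \<open>(1,1)\<close>-tensor field \<open>P\<close>
  and a 1-form \<open>u\<close>.\<close>

definition cov_tensor11 :: "('a \<Rightarrow> ('a, 'e) tvec \<Rightarrow> ('a \<Rightarrow> ('a, 'e) tvec) \<Rightarrow> ('a, 'e) tvec)
    \<Rightarrow> ('a \<Rightarrow> ('a, 'e::euclidean_space) tvec \<Rightarrow> ('a, 'e) tvec)
    \<Rightarrow> ('a \<Rightarrow> ('a, 'e) tvec) \<Rightarrow> ('a \<Rightarrow> ('a, 'e) tvec) \<Rightarrow> 'a \<Rightarrow> ('a, 'e) tvec" where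
  "cov_tensor11 D P X Y p = D p (X p) (\<lambda>q. P q (Y q)) - P p (D p (X p) Y)"

definition cov_form :: "('a, 'e::euclidean_space) manifold
    \<Rightarrow> ('a \<Rightarrow> ('a, 'e) tvec \<Rightarrow> ('a \<Rightarrow> ('a, 'e) tvec) \<Rightarrow> ('a, 'e) tvec)
    \<Rightarrow> ('a \<Rightarrow> ('a, 'e) tvec \<Rightarrow> real)
    \<Rightarrow> ('a \<Rightarrow> ('a, 'e) tvec) \<Rightarrow> ('a \<Rightarrow> ('a, 'e) tvec) \<Rightarrow> 'a \<Rightarrow> real" where
  "cov_form M D u X Y p = vderiv M p (X p) (\<lambda>q. u q (Y q)) - u p (D p (X p) Y)"

definition parallel11 :: "('a, 'e::euclidean_space) manifold
    \<Rightarrow> ('a \<Rightarrow> ('a, 'e) tvec \<Rightarrow> ('a \<Rightarrow> ('a, 'e) tvec) \<Rightarrow> ('a, 'e) tvec)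
    \<Rightarrow> ('a \<Rightarrow> ('a, 'e) tvec \<Rightarrow> ('a, 'e) tvec) \<Rightarrow> bool" where
  "parallel11 M D P \<longleftrightarrow> (\<forall>W. open_in M W \<longrightarrow>
     (\<forall>X\<in>vfields_on M W. \<forall>Y\<in>vfields_on M W. \<forall>p\<in>W. cov_tensor11 D P X Y p = 0))"

text \<open>The field with constant coordinate vector \<open>b\<close> in the chart \<open>d\<close>, over the domain of \<open>d\<close>.\<close>

definition coord_field :: "('a, 'e::euclidean_space) manifold \<Rightarrow> ('a, 'e) chart \<Rightarrow> 'e
    \<Rightarrow> 'a \<Rightarrow> ('a, 'e) tvec" where
  "coord_field M d b p = Tvec (\<lambda>c. if c \<in> atlas M \<and> p \<in> dom_of c then
     frechet_derivative (map_of_chart c \<circ> inv_chart d) (at (map_of_chart d p)) b else 0)"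

text \<open>The covariant derivative at \<open>p\<close> along \<open>v \<in> T\<^sub>pM\<close> of a vector field \<open>V\<close> along
  \<open>\<phi> : M \<rightarrow> N\<close>, induced by a connection \<open>D\<close> on \<open>N\<close>.  In a chart \<open>d\<close> of \<open>N\<close> around
  \<open>\<phi>(p)\<close> with coordinate fields \<open>E\<^sub>i\<close>, where \<open>V = (\<Sum>i. V\<^sub>i (E\<^sub>i \<circ> \<phi>))\<close>, it is
  \<open>(\<Sum>i. v(V\<^sub>i) E\<^sub>i + V\<^sub>i(p) D\<^bsub>\<phi>\<^sub>*v\<^esub> E\<^sub>i)\<close> at \<open>\<phi>(p)\<close>.  This is
  the meaning of \<open>D\<^sub>v V\<close> for a field \<open>V\<close> that is given only on a submanifold.\<close>

definition cov_along :: "('a, 'e::euclidean_space) manifold \<Rightarrow> ('b, 'f::euclidean_space) manifold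
    \<Rightarrow> ('a \<Rightarrow> 'b) \<Rightarrow> ('b \<Rightarrow> ('b, 'f) tvec \<Rightarrow> ('b \<Rightarrow> ('b, 'f) tvec) \<Rightarrow> ('b, 'f) tvec)
    \<Rightarrow> 'a \<Rightarrow> ('a, 'e) tvec \<Rightarrow> ('a \<Rightarrow> ('b, 'f) tvec) \<Rightarrow> ('b, 'f) tvec" where
  "cov_along M N \<phi> D p v V = Tvec (\<lambda>d. if d \<in> atlas N \<and> \<phi> p \<in> dom_of d then
     vderiv M p v (\<lambda>q. coords (V q) d) +
     coords (D (\<phi> p) (pushforward M N \<phi> p v) (coord_field N d (coords (V p) d))) d else 0)"

section \<open>Submanifolds with a normal frame and their induced structure\<close>

definition normal_frame :: "('a, 'e::euclidean_space) manifold \<Rightarrow> ('b, 'f::euclidean_space) manifold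
    \<Rightarrow> ('a \<Rightarrow> 'b) \<Rightarrow> ('b \<Rightarrow> ('b, 'f) tvec \<Rightarrow> ('b, 'f) tvec \<Rightarrow> real)
    \<Rightarrow> nat \<Rightarrow> (nat \<Rightarrow> 'a \<Rightarrow> ('b, 'f) tvec) \<Rightarrow> bool" where
  "normal_frame M N \<phi> g r \<nu> \<longleftrightarrow>
     (\<forall>\<alpha>\<in>{1..r}. \<nu> \<alpha> \<in> vfields_along M N \<phi> (points M)) \<and>
     (\<forall>p\<in>points M. \<forall>\<alpha>\<in>{1..r}.
        (\<forall>v\<in>tangent_space M p. g (\<phi> p) (pushforward M N \<phi> p v) (\<nu> \<alpha> p) = 0) \<and>
        (\<forall>\<beta>\<in>{1..r}. g (\<phi> p) (\<nu> \<alpha> p) (\<nu> \<beta> p) = (if \<alpha> = \<beta> then 1 else 0)))"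

text \<open>In the next two definitions \<open>Pt\<close> is the tensor field and \<open>Dt\<close> the connection of the ambient
  manifold \<open>N\<close>.\<close>

definition induced_structure :: "('a, 'e::euclidean_space) manifold \<Rightarrow> ('b, 'f::euclidean_space) manifold
    \<Rightarrow> ('a \<Rightarrow> 'b) \<Rightarrow> ('b \<Rightarrow> ('b, 'f) tvec \<Rightarrow> ('b, 'f) tvec)
    \<Rightarrow> real \<Rightarrow> nat \<Rightarrow> (nat \<Rightarrow> 'a \<Rightarrow> ('b, 'f) tvec)
    \<Rightarrow> ('a \<Rightarrow> ('a, 'e) tvec \<Rightarrow> ('a, 'e) tvec) \<Rightarrow> (nat \<Rightarrow> 'a \<Rightarrow> ('a, 'e) tvec \<Rightarrow> real)
    \<Rightarrow> (nat \<Rightarrow> 'a \<Rightarrow> ('a, 'e) tvec) \<Rightarrow> (nat \<Rightarrow> nat \<Rightarrow> 'a \<Rightarrow> real) \<Rightarrow> bool" where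
  "induced_structure M N \<phi> Pt \<epsilon> r \<nu> P u \<xi> a \<longleftrightarrow>
     tensor11 M P \<and>
     (\<forall>\<alpha>\<in>{1..r}. one_form M (u \<alpha>) \<and> \<xi> \<alpha> \<in> vfields M \<and>
        (\<forall>\<beta>\<in>{1..r}. smooth_fun_on M (points M) (a \<alpha> \<beta>))) \<and>
     (\<forall>p\<in>points M.
        (\<forall>v\<in>tangent_space M p. Pt (\<phi> p) (pushforward M N \<phi> p v) =
           pushforward M N \<phi> p (P p v) + (\<Sum>\<alpha>\<in>{1..r}. u \<alpha> p v *\<^sub>R \<nu> \<alpha> p)) \<and>
        (\<forall>\<alpha>\<in>{1..r}. Pt (\<phi> p) (\<nu> \<alpha> p) =
           \<epsilon> *\<^sub>R pushforward M N \<phi> p (\<xi> \<alpha> p) + (\<Sum>\<beta>\<in>{1..r}. a \<alpha> \<beta> p *\<^sub>R \<nu> \<beta> p)))"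

definition gauss_weingarten :: "('a, 'e::euclidean_space) manifold \<Rightarrow> ('b, 'f::euclidean_space) manifold
    \<Rightarrow> ('a \<Rightarrow> 'b)
    \<Rightarrow> ('b \<Rightarrow> ('b, 'f) tvec \<Rightarrow> ('b \<Rightarrow> ('b, 'f) tvec) \<Rightarrow> ('b, 'f) tvec)
    \<Rightarrow> ('a \<Rightarrow> ('a, 'e) tvec \<Rightarrow> ('a \<Rightarrow> ('a, 'e) tvec) \<Rightarrow> ('a, 'e) tvec)
    \<Rightarrow> nat \<Rightarrow> (nat \<Rightarrow> 'a \<Rightarrow> ('b, 'f) tvec)
    \<Rightarrow> (nat \<Rightarrow> 'a \<Rightarrow> ('a, 'e) tvec \<Rightarrow> ('a, 'e) tvec \<Rightarrow> real)
    \<Rightarrow> (nat \<Rightarrow> 'a \<Rightarrow> ('a, 'e) tvec \<Rightarrow> ('a, 'e) tvec)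
    \<Rightarrow> (nat \<Rightarrow> nat \<Rightarrow> 'a \<Rightarrow> ('a, 'e) tvec \<Rightarrow> real) \<Rightarrow> bool" where
  "gauss_weingarten M N \<phi> Dt D r \<nu> h A l \<longleftrightarrow>
     (\<forall>\<alpha>\<in>{1..r}. tensor02 M (h \<alpha>) \<and> tensor11 M (A \<alpha>) \<and> (\<forall>\<beta>\<in>{1..r}. one_form M (l \<alpha> \<beta>))) \<and>
     (\<forall>X\<in>vfields M. \<forall>Y\<in>vfields M. \<forall>p\<in>points M.
        cov_along M N \<phi> Dt p (X p) (\<lambda>q. pushforward M N \<phi> q (Y q)) =
          pushforward M N \<phi> p (D p (X p) Y) + (\<Sum>\<alpha>\<in>{1..r}. h \<alpha> p (X p) (Y p) *\<^sub>R \<nu> \<alpha> p)) \<and>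
     (\<forall>X\<in>vfields M. \<forall>\<alpha>\<in>{1..r}. \<forall>p\<in>points M.
        cov_along M N \<phi> Dt p (X p) (\<nu> \<alpha>) =
          - pushforward M N \<phi> p (A \<alpha> p (X p)) + (\<Sum>\<beta>\<in>{1..r}. l \<alpha> \<beta> p (X p) *\<^sub>R \<nu> \<beta> p))"

end

(*
  A field along the immersion is determined by its tangential part and its coefficients in the
  normal frame.  Since the ambient tensor field Pt is parallel, it commutes with the covariant
  derivative of fields along the immersion.  For the tangent field Y this reads
  D_X (Pt Y) = Pt (D_X Y): expanding both sides with the Gauss and Weingarten formulas, the
  tangential part is (i) and the normal part is (ii).  For the normal field nu_alpha in the place
  of Y the tangential part is (iii) and the normal part is (iv).  The normal parts also use that D
  is metric (so l is antisymmetric and h_alpha(X,Y) = g(A_alpha X, Y)) and that Pt is an isometry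
  with square eps (so u_alpha is dual to xi_alpha).

  Fields along the immersion are differentiated through their expansion in the coordinate fields of
  one ambient chart.  That the result is a tangent vector, i.e. independent of the chart, never has
  to be proved: for the fields that occur it is part of the Gauss-Weingarten formulas.
*)
theory Submission
  imports Defs
begin

text \<open>The obstacle: \<open>Y\<close> and the frame \<nu> live only along the immersion, while
  parallelism and metric compatibility of \<open>Dt\<close> speak of fields on open sets of the
  ambient manifold. No field is extended. Both hypotheses are applied to ambient coordinate fields
  alone, and the scalar coefficients, which are functions on the submanifold, obey the ordinary
  product rule. Since only a first derivative of each field at one point enters, the fields handled
  are those differentiable at a point (\<open>diff_along\<close>).

  Components are compared through \<open>decomp p v c\<close>, the vector with tangential part
  \<open>v\<close> and frame coefficients \<open>c\<close>: orthonormality recovers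
  \<open>c\<close>, and injectivity of the pushforward then recovers \<open>v\<close>.

  The duality carries no sign because two factors \<epsilon> cancel: u_\<alpha>(v) = g(Pt v,
  \<nu>_\<alpha>) = g(Pt Pt v, Pt \<nu>_\<alpha>) = \<epsilon> g(v, \<epsilon> \<xi>_\<alpha>) =
  g(v, \<xi>_\<alpha>). It is needed for (iv) only; antisymmetry of \<open>l\<close> enters (ii) and
  (iv), where the derivative of the frame produces \<open>l\<close> with its indices in the opposite
  order.\<close>

section \<open>Calculus of \<open>k\<close> times differentiable maps\<close>

lemma has_derivative_cong_open:
  assumes "open T" "x \<in> T" "\<And>y. y \<in> T \<Longrightarrow> f y = g y"
  shows "(f has_derivative f') (at x) \<longleftrightarrow> (g has_derivative f') (at x)"
  using assms has_derivative_transform_within_open[of f f' x UNIV T g]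
    has_derivative_transform_within_open[of g f' x UNIV T f] by auto

lemma frechet_derivative_cong_open:
  assumes "open T" "x \<in> T" "\<And>y. y \<in> T \<Longrightarrow> f y = g y"
  shows "frechet_derivative f (at x) = frechet_derivative g (at x)"
  unfolding frechet_derivative_def using has_derivative_cong_open[OF assms] by simp

lemma differentiable_cong_open:
  assumes "open T" "x \<in> T" "\<And>y. y \<in> T \<Longrightarrow> f y = g y"
  shows "f differentiable (at x) \<longleftrightarrow> g differentiable (at x)"
  unfolding differentiable_def using has_derivative_cong_open[OF assms] by simp

lemma has_derivative_frechet:
  "f differentiable (at x) \<Longrightarrow> (f has_derivative frechet_derivative f (at x)) (at x)"
  by (simp add: frechet_derivative_works)

lemma Ck_on_cong:
  assumes "open S" "\<And>x. x \<in> S \<Longrightarrow> f x = g x"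
  shows "Ck_on k S f \<longleftrightarrow> Ck_on k S g"
  using assms(2)
proof (induction k arbitrary: f g)
  case 0
  then show ?case by (simp cong: continuous_on_cong)
next
  case (Suc k)
  have d: "\<And>x. x \<in> S \<Longrightarrow> f differentiable (at x) \<longleftrightarrow> g differentiable (at x)"
    using differentiable_cong_open[OF assms(1)] Suc.prems by blast
  have "\<And>v. Ck_on k S (\<lambda>x. frechet_derivative f (at x) v)
      \<longleftrightarrow> Ck_on k S (\<lambda>x. frechet_derivative g (at x) v)"
    by (rule Suc.IH) (metis frechet_derivative_cong_open[OF assms(1)] Suc.prems)
  with d show ?case by simp
qed

lemma Ck_on_subset: "Ck_on k S f \<Longrightarrow> T \<subseteq> S \<Longrightarrow> Ck_on k T f"
  by (induction k arbitrary: f) (auto intro: continuous_on_subset)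

text \<open>Product and chain rule leave one factor undifferentiated, and their inductions need that
  factor at the lower order too.\<close>

lemma Ck_on_Suc_D: "Ck_on (Suc k) S f \<Longrightarrow> Ck_on k S f"
proof (induction k arbitrary: f)
  case 0
  then show ?case
    by (auto intro!: continuous_at_imp_continuous_on differentiable_imp_continuous_within)
next
  case (Suc k)
  then show ?case by (metis Ck_on.simps(2))
qed

lemma Ck_on_const [simp]: "Ck_on k S (\<lambda>x. c)"
  by (induction k arbitrary: c) auto

lemma Ck_on_bounded_linear:
  assumes L: "bounded_linear L" and "open S" "Ck_on k S f"
  shows "Ck_on k S (\<lambda>x. L (f x))"
  using assms(3)
proof (induction k arbitrary: f)
  case 0
  then show ?case by (auto intro: bounded_linear.continuous_on[OF L])
next
  case (Suc k)
  have d: "((\<lambda>x. L (f x)) has_derivative (\<lambda>v. L (frechet_derivative f (at x) v))) (at x)"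
    if "x \<in> S" for x
    using Suc.prems that by (intro bounded_linear.has_derivative[OF L] has_derivative_frechet) auto
  have "Ck_on k S (\<lambda>x. frechet_derivative (\<lambda>x. L (f x)) (at x) v)" for v
  proof (subst Ck_on_cong[OF \<open>open S\<close>])
    show "frechet_derivative (\<lambda>x. L (f x)) (at x) v = L (frechet_derivative f (at x) v)"
      if "x \<in> S" for x using frechet_derivative_at[OF d[OF that]] by metis
    show "Ck_on k S (\<lambda>x. L (frechet_derivative f (at x) v))" using Suc by simp
  qed
  then show ?case using d by (auto simp: differentiable_def)
qed

lemma Ck_on_add:
  assumes "open S" "Ck_on k S f" "Ck_on k S g"
  shows "Ck_on k S (\<lambda>x. f x + g x)"
  using assms(2,3)
proof (induction k arbitrary: f g)
  case 0
  then show ?case by (auto intro: continuous_intros)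
next
  case (Suc k)
  have d: "((\<lambda>x. f x + g x) has_derivative
      (\<lambda>v. frechet_derivative f (at x) v + frechet_derivative g (at x) v)) (at x)"
    if "x \<in> S" for x
    using Suc.prems that by (intro has_derivative_add has_derivative_frechet) auto
  have "Ck_on k S (\<lambda>x. frechet_derivative (\<lambda>x. f x + g x) (at x) v)" for v
  proof (subst Ck_on_cong[OF \<open>open S\<close>])
    show "frechet_derivative (\<lambda>x. f x + g x) (at x) v
        = frechet_derivative f (at x) v + frechet_derivative g (at x) v"
      if "x \<in> S" for x using frechet_derivative_at[OF d[OF that]] by metis
    show "Ck_on k S (\<lambda>x. frechet_derivative f (at x) v + frechet_derivative g (at x) v)"
      using Suc by simp
  qed
  then show ?case using d by (auto simp: differentiable_def)
qed

lemma Ck_on_sum: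
  assumes "open S" "\<And>i. i \<in> I \<Longrightarrow> Ck_on k S (f i)"
  shows "Ck_on k S (\<lambda>x. \<Sum>i\<in>I. f i x)"
  using assms(2)
  by (induction I rule: infinite_finite_induct) (auto intro: Ck_on_add[OF assms(1)])

lemma Ck_on_bilinear:
  assumes B: "bounded_bilinear pr" and "open S" "Ck_on k S f" "Ck_on k S g"
  shows "Ck_on k S (\<lambda>x. pr (f x) (g x))"
  using assms(3,4)
proof (induction k arbitrary: f g)
  case 0
  then show ?case by (auto intro: bounded_bilinear.continuous_on[OF B])
next
  case (Suc k)
  have d: "((\<lambda>x. pr (f x) (g x)) has_derivative
      (\<lambda>v. pr (f x) (frechet_derivative g (at x) v)
         + pr (frechet_derivative f (at x) v) (g x))) (at x)"
    if "x \<in> S" for x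
    using Suc.prems that by (intro bounded_bilinear.FDERIV[OF B] has_derivative_frechet) auto
  have "Ck_on k S (\<lambda>x. frechet_derivative (\<lambda>x. pr (f x) (g x)) (at x) v)" for v
  proof (subst Ck_on_cong[OF \<open>open S\<close>])
    show "frechet_derivative (\<lambda>x. pr (f x) (g x)) (at x) v
        = pr (f x) (frechet_derivative g (at x) v) + pr (frechet_derivative f (at x) v) (g x)"
      if "x \<in> S" for x using frechet_derivative_at[OF d[OF that]] by metis
    have "Ck_on k S f" "Ck_on k S g" using Suc.prems Ck_on_Suc_D by blast+
    then show "Ck_on k S (\<lambda>x. pr (f x) (frechet_derivative g (at x) v)
        + pr (frechet_derivative f (at x) v) (g x))"
      using Suc by (intro Ck_on_add[OF \<open>open S\<close>]) simp_all
  qed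
  then show ?case using d by (auto simp: differentiable_def)
qed

text \<open>Trades a linear map applied to a varying vector for finitely many fixed directions with
  varying scalar coefficients; product rules can then be applied.\<close>

lemma linear_eq_sum_Basis:
  fixes F :: "'e::euclidean_space \<Rightarrow> 'g::real_vector"
  assumes "linear F"
  shows "F v = (\<Sum>b\<in>Basis. (v \<bullet> b) *\<^sub>R F b)"
proof -
  have "F (\<Sum>b\<in>Basis. (v \<bullet> b) *\<^sub>R b) = (\<Sum>b\<in>Basis. (v \<bullet> b) *\<^sub>R F b)"
    by (simp add: linear_sum[OF assms] linear_scale[OF assms])
  then show ?thesis by (simp add: euclidean_representation)
qed

text \<open>The chain rule differentiates \<open>g\<close> in the direction
  \<open>frechet_derivative f (at x) v\<close>, which moves with \<open>x\<close>, whereas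
  \<open>Ck_on\<close> speaks of fixed directions. Expanding that direction in \<open>Basis\<close>
  repairs this; the induction is over all \<open>g\<close>, because its hypothesis is applied to the
  directional derivatives of \<open>g\<close> with the same \<open>f\<close>.\<close>

lemma Ck_on_compose:
  fixes f :: "'e::real_normed_vector \<Rightarrow> 'f::euclidean_space" and g :: "'f \<Rightarrow> 'g::real_normed_vector"
  assumes "open S" "f ` S \<subseteq> T" "Ck_on k S f" "Ck_on k T g"
  shows "Ck_on k S (g \<circ> f)"
  using assms(3,4)
proof (induction k arbitrary: g)
  case 0
  then show ?case using assms(2) by (auto intro: continuous_on_compose2)
next
  case (Suc k)
  have d: "(g \<circ> f has_derivative
      frechet_derivative g (at (f x)) \<circ> frechet_derivative f (at x)) (at x)"
    if "x \<in> S" for x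
    using Suc.prems that assms(2) by (intro diff_chain_at has_derivative_frechet) auto
  have "Ck_on k S (\<lambda>x. frechet_derivative (g \<circ> f) (at x) v)" for v
  proof (subst Ck_on_cong[OF \<open>open S\<close>])
    show "frechet_derivative (g \<circ> f) (at x) v = (\<Sum>b\<in>Basis.
        (frechet_derivative f (at x) v \<bullet> b) *\<^sub>R ((\<lambda>y. frechet_derivative g (at y) b) \<circ> f) x)"
      if "x \<in> S" for x
    proof -
      have "linear (frechet_derivative g (at (f x)))"
        using Suc.prems that assms(2) by (intro linear_frechet_derivative) auto
      from linear_eq_sum_Basis[OF this, of "frechet_derivative f (at x) v"] show ?thesis
        by (simp only: fun_cong[OF frechet_derivative_at[OF d[OF that], THEN sym], of v] o_apply)
    qed
    have "Ck_on k S f" using Suc.prems Ck_on_Suc_D by blast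
    moreover have "Ck_on k S (\<lambda>x. frechet_derivative f (at x) v \<bullet> b)" for b
      using Suc.prems(1)
      by (intro Ck_on_bounded_linear[OF bounded_linear_inner_left \<open>open S\<close>]) simp
    moreover have "Ck_on k S (\<lambda>x. ((\<lambda>y. frechet_derivative g (at y) b) \<circ> f) x)" for b
      using Suc.IH[OF \<open>Ck_on k S f\<close>, of "\<lambda>y. frechet_derivative g (at y) b"] Suc.prems(2)
      by (simp add: o_def)
    ultimately show "Ck_on k S (\<lambda>x. \<Sum>b\<in>Basis.
        (frechet_derivative f (at x) v \<bullet> b) *\<^sub>R ((\<lambda>y. frechet_derivative g (at y) b) \<circ> f) x)"
      by (intro Ck_on_sum[OF \<open>open S\<close>] Ck_on_bilinear[OF bounded_bilinear_scaleR \<open>open S\<close>])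
  qed
  then show ?case using d unfolding Ck_on.simps differentiable_def by blast
qed

lemma smooth_on_imp_differentiable: "smooth_on S f \<Longrightarrow> x \<in> S \<Longrightarrow> f differentiable (at x)"
  by (metis smooth_on_def Ck_on.simps(2))

lemma smooth_on_frechet: "smooth_on S f \<Longrightarrow> smooth_on S (\<lambda>x. frechet_derivative f (at x) v)"
  by (metis smooth_on_def Ck_on.simps(2))

section \<open>Differentiation on a manifold\<close>

lemmas coords_simps [simp] =
  zero_tvec.rep_eq plus_tvec.rep_eq minus_tvec.rep_eq uminus_tvec.rep_eq scaleR_tvec.rep_eq

lemma coords_Tvec [simp]: "coords (Tvec f) = f"
  by (simp add: Tvec_inverse)

lemma coords_sum [simp]: "coords (\<Sum>i\<in>I. f i) c = (\<Sum>i\<in>I. coords (f i) c)"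
  by (induction I rule: infinite_finite_induct) auto

lemma coords_linear: "linear (\<lambda>v. coords v d)"
  by (rule linearI) simp_all

lemma tvec_eqI: "(\<And>c. coords v c = coords w c) \<Longrightarrow> v = w"
  by (simp add: coords_inject[symmetric] fun_eq_iff)

text \<open>Uses the very chart in which \<open>vderiv\<close> is computed, so the calculus rules
  carry over from Euclidean space without any change of chart.\<close>

definition mdiff :: "('a, 'e::euclidean_space) manifold \<Rightarrow> 'a \<Rightarrow> ('a \<Rightarrow> 'g::real_normed_vector) \<Rightarrow> bool"
  where "mdiff M p f \<longleftrightarrow>
    (f \<circ> inv_chart (chart_at M p)) differentiable (at (map_of_chart (chart_at M p) p))"

lemma mdiff_has_derivative:
  "mdiff M p f \<Longrightarrow> ((\<lambda>y. f (inv_chart (chart_at M p) y)) has_derivative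
    frechet_derivative (f \<circ> inv_chart (chart_at M p)) (at (map_of_chart (chart_at M p) p)))
    (at (map_of_chart (chart_at M p) p))"
  unfolding mdiff_def by (drule has_derivative_frechet) (simp add: o_def)

text \<open>One \<open>has_derivative\<close> fact gives both differentiability and the value, so
  each rule below is a Euclidean derivative rule fed into this lemma.\<close>

lemma vderivI:
  assumes "((\<lambda>y. f (inv_chart (chart_at M p) y)) has_derivative F)
    (at (map_of_chart (chart_at M p) p))"
  shows "mdiff M p f" "vderiv M p v f = F (coords v (chart_at M p))"
proof -
  have *: "(f \<circ> inv_chart (chart_at M p) has_derivative F) (at (map_of_chart (chart_at M p) p))"
    using assms by (simp add: o_def)
  then show "mdiff M p f" unfolding mdiff_def differentiable_def by blast
  show "vderiv M p v f = F (coords v (chart_at M p))"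
    unfolding vderiv_def by (simp only: frechet_derivative_at[OF *])
qed

lemma
  assumes "mdiff M p f" "mdiff M p g"
  shows mdiff_add: "mdiff M p (\<lambda>q. f q + g q)"
    and vderiv_add: "vderiv M p v (\<lambda>q. f q + g q) = vderiv M p v f + vderiv M p v g"
  using vderivI[OF has_derivative_add[OF mdiff_has_derivative[OF assms(1)] mdiff_has_derivative[OF assms(2)]]]
  by (auto simp: vderiv_def)

lemma mdiff_const: "mdiff M p (\<lambda>q. c)"
  and vderiv_const: "vderiv M p v (\<lambda>q. c) = 0"
  by (rule vderivI[OF has_derivative_const])+

lemma
  assumes "\<And>i. i \<in> I \<Longrightarrow> mdiff M p (f i)"
  shows mdiff_sum: "mdiff M p (\<lambda>q. \<Sum>i\<in>I. f i q)"
    and vderiv_sum: "vderiv M p v (\<lambda>q. \<Sum>i\<in>I. f i q) = (\<Sum>i\<in>I. vderiv M p v (f i))"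
proof -
  have "mdiff M p (\<lambda>q. \<Sum>i\<in>I. f i q) \<and>
      vderiv M p v (\<lambda>q. \<Sum>i\<in>I. f i q) = (\<Sum>i\<in>I. vderiv M p v (f i))"
    using assms
    by (induction I rule: infinite_finite_induct)
      (auto simp: mdiff_const vderiv_const mdiff_add vderiv_add)
  then show "mdiff M p (\<lambda>q. \<Sum>i\<in>I. f i q)"
    "vderiv M p v (\<lambda>q. \<Sum>i\<in>I. f i q) = (\<Sum>i\<in>I. vderiv M p v (f i))" by auto
qed

lemma
  assumes "bounded_linear L" "mdiff M p f"
  shows mdiff_linear: "mdiff M p (\<lambda>q. L (f q))"
    and vderiv_linear: "vderiv M p v (\<lambda>q. L (f q)) = L (vderiv M p v f)"
  using vderivI[OF bounded_linear.has_derivative[OF assms(1) mdiff_has_derivative[OF assms(2)]]]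
  by (auto simp: vderiv_def)

lemmas mdiff_inner = mdiff_linear[OF bounded_linear_inner_left]
  and vderiv_inner = vderiv_linear[OF bounded_linear_inner_left]

lemma vderiv_tangent_linear:
  assumes "mdiff M p f"
  shows "vderiv M p (a *\<^sub>R v + b *\<^sub>R w) f = a *\<^sub>R vderiv M p v f + b *\<^sub>R vderiv M p w f"
  using linear_frechet_derivative[OF assms[unfolded mdiff_def]]
  by (simp add: vderiv_def linear_add linear_scale)

lemma smooth_on_cong:
  "open S \<Longrightarrow> (\<And>x. x \<in> S \<Longrightarrow> f x = g x) \<Longrightarrow> smooth_on S f \<longleftrightarrow> smooth_on S g"
  unfolding smooth_on_def using Ck_on_cong by blast

text \<open>Tensors are constrained only on tangent vectors, so every summand has to be known to lie
  in \<open>T\<close> before a sum may be pulled out.\<close>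

lemma linear_over_sum:
  assumes T: "subspace T" and F: "linear_over T F" and f: "\<And>i. i \<in> I \<Longrightarrow> f i \<in> T"
  shows "F (\<Sum>i\<in>I. c i *\<^sub>R f i) = (\<Sum>i\<in>I. c i *\<^sub>R F (f i))"
  using f
proof (induction I rule: infinite_finite_induct)
  case (insert i I)
  then have "(\<Sum>i\<in>I. c i *\<^sub>R f i) \<in> T"
    by (intro subspace_sum[OF T] subspace_scale[OF T]) auto
  then have "F (c i *\<^sub>R f i + 1 *\<^sub>R (\<Sum>i\<in>I. c i *\<^sub>R f i))
      = c i *\<^sub>R F (f i) + 1 *\<^sub>R F (\<Sum>i\<in>I. c i *\<^sub>R f i)"
    using F insert.prems unfolding linear_over_def by (metis insertI1)
  then show ?case using insert by simp
qed (use F subspace_0[OF T] linear_over_def[of T F] in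
      \<open>force dest: bspec[where x = 0] spec[where x = "0::real"]\<close>)+

lemma
  assumes T: "subspace T" and F: "linear_over T F" and v: "v \<in> T"
  shows linear_over_scale: "F (c *\<^sub>R v) = c *\<^sub>R F v"
    and linear_over_add: "w \<in> T \<Longrightarrow> F (v + w) = F v + F w"
    and linear_over_minus: "F (- v) = - F v"
proof -
  have *: "F (a *\<^sub>R x + b *\<^sub>R y) = a *\<^sub>R F x + b *\<^sub>R F y" if "x \<in> T" "y \<in> T" for a b x y
    using F that unfolding linear_over_def by blast
  show "F (c *\<^sub>R v) = c *\<^sub>R F v" using *[OF v v, of c 0] by simp
  show "F (- v) = - F v" using *[OF v v, of "-1" 0] by simp
  show "F (v + w) = F v + F w" if "w \<in> T" using *[OF v that, of 1 1] by simp
qed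

locale smooth_mfd =
  fixes M :: "('a, 'e::euclidean_space) manifold"
  assumes mfd: "smooth_manifold M"
begin

section \<open>Charts, their inverses and transition maps\<close>

lemma open_dom: "c \<in> atlas M \<Longrightarrow> open_in M (dom_of c)"
  using mfd unfolding smooth_manifold_def by blast

lemma dom_subset: "c \<in> atlas M \<Longrightarrow> p \<in> dom_of c \<Longrightarrow> p \<in> points M"
  using open_dom openin_subset by blast

lemma chart_at:
  assumes "p \<in> points M"
  shows "chart_at M p \<in> atlas M" "p \<in> dom_of (chart_at M p)"
proof -
  have "\<exists>c. c \<in> atlas M \<and> p \<in> dom_of c"
    using assms mfd unfolding smooth_manifold_def by blast
  from someI_ex[OF this] show "chart_at M p \<in> atlas M" "p \<in> dom_of (chart_at M p)"
    unfolding chart_at_def by blast+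
qed

lemma
  assumes "c \<in> atlas M"
  shows chart_homeomorphic: "homeomorphic_map (subtopology (topology_of M) (dom_of c))
          (top_of_set (map_of_chart c ` dom_of c)) (map_of_chart c)"
    and open_chart_image: "open (map_of_chart c ` dom_of c)"
  using assms mfd unfolding smooth_manifold_def by blast+

lemma inv_chart_map:
  assumes "c \<in> atlas M" "q \<in> dom_of c"
  shows "inv_chart c (map_of_chart c q) = q"
proof -
  have "points M \<inter> dom_of c = dom_of c" using dom_subset[OF assms(1)] by blast
  then have "inj_on (map_of_chart c) (dom_of c)"
    using homeomorphic_imp_injective_map[OF chart_homeomorphic[OF assms(1)]] by simp
  then show ?thesis unfolding inv_chart_def using assms(2) by simp
qed

lemma open_image:
  assumes "c \<in> atlas M" "open_in M W"
  shows "open (map_of_chart c ` (dom_of c \<inter> W))"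
proof -
  have "openin (subtopology (topology_of M) (dom_of c)) (dom_of c \<inter> W)"
    using assms(2) by (auto simp: openin_subtopology)
  then have "openin (top_of_set (map_of_chart c ` dom_of c)) (map_of_chart c ` (dom_of c \<inter> W))"
    using homeomorphic_imp_open_map[OF chart_homeomorphic[OF assms(1)]] unfolding open_map_def by blast
  then show ?thesis using open_chart_image[OF assms(1)] openin_open_eq by blast
qed

lemma transition_smooth:
  "c \<in> atlas M \<Longrightarrow> d \<in> atlas M \<Longrightarrow>
    smooth_on (map_of_chart c ` (dom_of c \<inter> dom_of d)) (map_of_chart d \<circ> inv_chart c)"
  using mfd unfolding smooth_manifold_def by blast

lemma transition_differentiable:
  "c \<in> atlas M \<Longrightarrow> d \<in> atlas M \<Longrightarrow> p \<in> dom_of c \<Longrightarrow> p \<in> dom_of d \<Longrightarrow>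
    (map_of_chart d \<circ> inv_chart c) differentiable (at (map_of_chart c p))"
  by (rule smooth_on_imp_differentiable[OF transition_smooth]) auto

section \<open>Locality, product and chain rules for the derivative along a tangent vector\<close>

lemma
  assumes "p \<in> U" "open_in M U" "\<And>q. q \<in> U \<Longrightarrow> f q = g q"
  shows vderiv_cong: "vderiv M p v f = vderiv M p v g"
    and mdiff_cong: "mdiff M p f \<longleftrightarrow> mdiff M p g"
proof -
  have p: "p \<in> points M" using assms openin_subset by blast
  note c = chart_at[OF p]
  let ?T = "map_of_chart (chart_at M p) ` (dom_of (chart_at M p) \<inter> U)"
  have "open ?T" "map_of_chart (chart_at M p) p \<in> ?T"
    using open_image c assms by auto
  moreover have "(f \<circ> inv_chart (chart_at M p)) y = (g \<circ> inv_chart (chart_at M p)) y" if "y \<in> ?T" for y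
    using that inv_chart_map[OF c(1)] assms(3) by auto
  ultimately show "vderiv M p v f = vderiv M p v g" "mdiff M p f \<longleftrightarrow> mdiff M p g"
    unfolding vderiv_def mdiff_def
    using frechet_derivative_cong_open[of ?T _ "f \<circ> inv_chart (chart_at M p)" "g \<circ> inv_chart (chart_at M p)"]
      differentiable_cong_open[of ?T _ "f \<circ> inv_chart (chart_at M p)" "g \<circ> inv_chart (chart_at M p)"]
    by simp_all
qed

lemma
  assumes "p \<in> points M" "bounded_bilinear pr" "mdiff M p f" "mdiff M p g"
  shows mdiff_bilinear: "mdiff M p (\<lambda>q. pr (f q) (g q))"
    and vderiv_bilinear: "vderiv M p v (\<lambda>q. pr (f q) (g q))
      = pr (vderiv M p v f) (g p) + pr (f p) (vderiv M p v g)"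
  using vderivI[OF bounded_bilinear.FDERIV[OF assms(2) mdiff_has_derivative[OF assms(3)]
        mdiff_has_derivative[OF assms(4)]]] inv_chart_map[OF chart_at[OF assms(1)]]
  by (auto simp: vderiv_def)

lemmas mdiff_scaleR = mdiff_bilinear[OF _ bounded_bilinear_scaleR]
  and vderiv_scaleR = vderiv_bilinear[OF _ bounded_bilinear_scaleR]
  and mdiff_mult = mdiff_bilinear[OF _ bounded_bilinear_mult]
  and vderiv_mult = vderiv_bilinear[OF _ bounded_bilinear_mult]

lemma
  assumes "p \<in> points M" "mdiff M p G" "F differentiable (at (G p))"
  shows mdiff_compose: "mdiff M p (\<lambda>q. F (G q))"
    and vderiv_compose: "vderiv M p v (\<lambda>q. F (G q))
      = frechet_derivative F (at (G p)) (vderiv M p v G)"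
proof -
  have *: "(F has_derivative frechet_derivative F (at (G p)))
      (at (G (inv_chart (chart_at M p) (map_of_chart (chart_at M p) p))))"
    using has_derivative_frechet[OF assms(3)] inv_chart_map[OF chart_at[OF assms(1)]] by simp
  show "mdiff M p (\<lambda>q. F (G q))" "vderiv M p v (\<lambda>q. F (G q))
      = frechet_derivative F (at (G p)) (vderiv M p v G)"
    using vderivI[OF has_derivative_compose[OF mdiff_has_derivative[OF assms(2)] *]]
    by (auto simp: vderiv_def)
qed

lemma smooth_fun_on_imp_mdiff:
  assumes "smooth_fun_on M W f" "p \<in> W" "p \<in> points M"
  shows "mdiff M p f"
  unfolding mdiff_def
  using assms chart_at[OF assms(3)] unfolding smooth_fun_on_def
  by (intro smooth_on_imp_differentiable) auto

lemma smooth_fun_on_subset: "smooth_fun_on M W f \<Longrightarrow> V \<subseteq> W \<Longrightarrow> smooth_fun_on M V f"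
  unfolding smooth_fun_on_def smooth_on_def by (meson Ck_on_subset image_mono Int_mono order_refl)

lemma smooth_fun_on_const: "smooth_fun_on M W (\<lambda>q. c)"
  unfolding smooth_fun_on_def smooth_on_def by (simp add: o_def)

lemma smooth_fun_on_add:
  assumes "open_in M W" "smooth_fun_on M W f" "smooth_fun_on M W g"
  shows "smooth_fun_on M W (\<lambda>q. f q + g q)"
  using assms unfolding smooth_fun_on_def smooth_on_def o_def
  by (intro ballI allI Ck_on_add open_image) auto

lemma smooth_fun_on_scaleR:
  assumes "open_in M W" "smooth_fun_on M W f" "smooth_fun_on M W g"
  shows "smooth_fun_on M W (\<lambda>q. f q *\<^sub>R g q)"
  using assms unfolding smooth_fun_on_def smooth_on_def o_def
  by (intro ballI allI Ck_on_bilinear[OF bounded_bilinear_scaleR] open_image) auto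

lemma smooth_fun_on_inner:
  assumes "open_in M W" "smooth_fun_on M W f"
  shows "smooth_fun_on M W (\<lambda>q. f q \<bullet> b)"
  using assms unfolding smooth_fun_on_def smooth_on_def o_def
  by (intro ballI allI Ck_on_bounded_linear[OF bounded_linear_inner_left] open_image) auto

section \<open>Tangent spaces and their dependence on a single chart\<close>

lemma tangent_coords:
  "v \<in> tangent_space M p \<Longrightarrow> c \<in> atlas M \<Longrightarrow> d \<in> atlas M \<Longrightarrow> p \<in> dom_of c \<Longrightarrow> p \<in> dom_of d \<Longrightarrow>
    coords v d = frechet_derivative (map_of_chart d \<circ> inv_chart c) (at (map_of_chart c p)) (coords v c)"
  unfolding tangent_space_def by blast

lemma tangentI:
  assumes "\<And>c d. c \<in> atlas M \<Longrightarrow> d \<in> atlas M \<Longrightarrow> p \<in> dom_of c \<Longrightarrow> p \<in> dom_of d \<Longrightarrow>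
    coords v d = frechet_derivative (map_of_chart d \<circ> inv_chart c) (at (map_of_chart c p)) (coords v c)"
    and "\<And>c. \<not> (c \<in> atlas M \<and> p \<in> dom_of c) \<Longrightarrow> coords v c = 0"
  shows "v \<in> tangent_space M p"
  unfolding tangent_space_def using assms by blast

lemma tangent_coords_0:
  "v \<in> tangent_space M p \<Longrightarrow> \<not> (c \<in> atlas M \<and> p \<in> dom_of c) \<Longrightarrow> coords v c = 0"
  unfolding tangent_space_def by blast

text \<open>The transformation law carries the coordinates in \<open>d\<close> to every other chart
  around \<open>p\<close>, and all remaining indices hold the default value 0. Identities between
  tangent vectors are therefore checked in one convenient chart.\<close>

lemma tangent_eqI:
  assumes "v \<in> tangent_space M p" "w \<in> tangent_space M p" "d \<in> atlas M" "p \<in> dom_of d"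
    "coords v d = coords w d"
  shows "v = w"
proof (rule tvec_eqI)
  show "coords v c = coords w c" for c
    using tangent_coords[OF assms(1,3) _ assms(4), of c] tangent_coords[OF assms(2,3) _ assms(4), of c]
      tangent_coords_0[OF assms(1), of c] tangent_coords_0[OF assms(2), of c] assms(5)
    by (cases "c \<in> atlas M \<and> p \<in> dom_of c") auto
qed

lemma subspace_tangent: "subspace (tangent_space M p)"
proof -
  have "linear (frechet_derivative (map_of_chart d \<circ> inv_chart c) (at (map_of_chart c p)))"
    if "c \<in> atlas M" "d \<in> atlas M" "p \<in> dom_of c" "p \<in> dom_of d" for c d
    using linear_frechet_derivative[OF transition_differentiable[OF that]] .
  note lin = linear_0[OF this] linear_add[OF this] linear_scale[OF this]
  show ?thesis
  proof (rule subspaceI)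
    show "0 \<in> tangent_space M p" by (rule tangentI) (simp_all add: lin)
    show "v + w \<in> tangent_space M p" if "v \<in> tangent_space M p" "w \<in> tangent_space M p" for v w
      by (rule tangentI) (simp_all add: lin tangent_coords_0[OF that(1)] tangent_coords_0[OF that(2)]
          tangent_coords[OF that(1), symmetric] tangent_coords[OF that(2), symmetric])
    show "r *\<^sub>R v \<in> tangent_space M p" if "v \<in> tangent_space M p" for r v
      by (rule tangentI) (simp_all add: lin tangent_coords_0[OF that] tangent_coords[OF that, symmetric])
  qed
qed

lemmas tangent_add = subspace_add[OF subspace_tangent]
  and tangent_scale = subspace_scale[OF subspace_tangent]
  and tangent_neg = subspace_neg[OF subspace_tangent]
  and tangent_0 = subspace_0[OF subspace_tangent]
  and tangent_sum = subspace_sum[OF subspace_tangent]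

text \<open>Chain rule for the factorisation of \<open>f \<circ> inv_chart c\<close> through the
  chart \<open>d\<close>. The factorisation holds only on the image of the overlap of the two
  domains, an open neighbourhood of the point.\<close>

lemma rep_change_chart:
  assumes "c \<in> atlas M" "d \<in> atlas M" "p \<in> dom_of c" "p \<in> dom_of d"
    and f: "(f \<circ> inv_chart d) differentiable (at (map_of_chart d p))"
  shows "(f \<circ> inv_chart c has_derivative
      frechet_derivative (f \<circ> inv_chart d) (at (map_of_chart d p)) \<circ>
      frechet_derivative (map_of_chart d \<circ> inv_chart c) (at (map_of_chart c p))) (at (map_of_chart c p))"
proof -
  let ?T = "map_of_chart c ` (dom_of c \<inter> dom_of d)"
  have p: "(map_of_chart d \<circ> inv_chart c) (map_of_chart c p) = map_of_chart d p"
    using inv_chart_map assms by simp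
  have T: "open ?T" "map_of_chart c p \<in> ?T" using open_image open_dom assms by auto
  have eq: "((f \<circ> inv_chart d) \<circ> (map_of_chart d \<circ> inv_chart c)) y = (f \<circ> inv_chart c) y"
    if "y \<in> ?T" for y
    using that by (auto simp: inv_chart_map[OF assms(1)] inv_chart_map[OF assms(2)])
  have "((f \<circ> inv_chart d) \<circ> (map_of_chart d \<circ> inv_chart c) has_derivative
      frechet_derivative (f \<circ> inv_chart d) (at (map_of_chart d p)) \<circ>
      frechet_derivative (map_of_chart d \<circ> inv_chart c) (at (map_of_chart c p))) (at (map_of_chart c p))"
    using has_derivative_frechet[OF f] p
    by (intro diff_chain_at has_derivative_frechet transition_differentiable assms) simp_all
  then show ?thesis by (rule has_derivative_transform_within_open[OF _ T eq])
qed

text \<open>The Jacobian from the change of chart is absorbed by the transformation law of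
  \<open>v\<close>. This matters when the base point moves: \<open>chart_at M p\<close> may jump
  with \<open>p\<close>, and the lemma allows one fixed chart for all nearby points.\<close>

lemma vderiv_chart:
  assumes "d \<in> atlas M" "p \<in> dom_of d" "v \<in> tangent_space M p"
    and f: "(f \<circ> inv_chart d) differentiable (at (map_of_chart d p))"
  shows "vderiv M p v f = frechet_derivative (f \<circ> inv_chart d) (at (map_of_chart d p)) (coords v d)"
proof -
  note c = chart_at[OF dom_subset[OF assms(1,2)]]
  have "coords v d = frechet_derivative (map_of_chart d \<circ> inv_chart (chart_at M p))
      (at (map_of_chart (chart_at M p) p)) (coords v (chart_at M p))"
    using tangent_coords[OF assms(3) c(1) assms(1) c(2) assms(2)] .
  then show ?thesis
    using frechet_derivative_at[OF rep_change_chart[OF c(1) assms(1) c(2) assms(2) f]]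
    unfolding vderiv_def by (metis comp_apply)
qed

section \<open>Coordinate fields of a chart\<close>

lemma coords_coord_field:
  "c \<in> atlas M \<Longrightarrow> q \<in> dom_of c \<Longrightarrow> coords (coord_field M d b q) c
    = frechet_derivative (map_of_chart c \<circ> inv_chart d) (at (map_of_chart d q)) b"
  by (simp add: coord_field_def)

lemma coords_coord_field_same:
  assumes "d \<in> atlas M" "q \<in> dom_of d"
  shows "coords (coord_field M d b q) d = b"
proof -
  let ?T = "map_of_chart d ` dom_of d"
  have "frechet_derivative (map_of_chart d \<circ> inv_chart d) (at (map_of_chart d q))
      = frechet_derivative (\<lambda>x. x) (at (map_of_chart d q))"
    by (rule frechet_derivative_cong_open[OF open_chart_image[OF assms(1)]])
      (use assms in \<open>auto simp: inv_chart_map[OF assms(1)]\<close>)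
  then show ?thesis using coords_coord_field[OF assms] by simp
qed

text \<open>The transformation law is the chain rule for passing from \<open>d\<close> to
  \<open>c\<close> and on to \<open>c'\<close>: \<open>rep_change_chart\<close> with a chart map in
  the place of the function.\<close>

lemma coord_field_tangent:
  assumes "d \<in> atlas M" "q \<in> dom_of d"
  shows "coord_field M d b q \<in> tangent_space M q"
proof -
  show ?thesis
  proof (rule tangentI)
    show "coords (coord_field M d b q) c' = frechet_derivative (map_of_chart c' \<circ> inv_chart c)
      (at (map_of_chart c q)) (coords (coord_field M d b q) c)"
    if "c \<in> atlas M" "c' \<in> atlas M" "q \<in> dom_of c" "q \<in> dom_of c'" for c c'
    using fun_cong[OF frechet_derivative_at[OF rep_change_chart[OF assms(1) that(1) assms(2) that(3)
        transition_differentiable[OF that]]], of b]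
    by (simp only: coords_coord_field[OF that(1,3)] coords_coord_field[OF that(2,4)] o_apply)
  qed (auto simp: coord_field_def)
qed

text \<open>Seen from a chart \<open>e\<close>, the components in \<open>c\<close> are a directional
  derivative of the transition from \<open>d\<close> to \<open>c\<close>, composed with the
  transition from \<open>e\<close> to \<open>d\<close>. Both factors are smooth, hence so is the
  composite.\<close>

lemma coord_field_vfields:
  assumes d: "d \<in> atlas M"
  shows "coord_field M d b \<in> vfields_on M (dom_of d)"
proof -
  have "smooth_on (map_of_chart e ` (dom_of e \<inter> {q \<in> dom_of d. q \<in> dom_of c}))
      ((\<lambda>q. coords (coord_field M d b q) c) \<circ> inv_chart e)"
    if c: "c \<in> atlas M" and e: "e \<in> atlas M" for c e
  proof -
    let ?S = "map_of_chart e ` (dom_of e \<inter> (dom_of d \<inter> dom_of c))"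
    let ?F = "\<lambda>x. frechet_derivative (map_of_chart c \<circ> inv_chart d) (at x) b"
    have S: "open ?S" using open_image[OF e openin_Int[OF open_dom[OF d] open_dom[OF c]]] .
    have "smooth_on ?S (?F \<circ> (map_of_chart d \<circ> inv_chart e))"
      unfolding smooth_on_def
    proof
      fix k
      show "Ck_on k ?S (?F \<circ> (map_of_chart d \<circ> inv_chart e))"
      proof (rule Ck_on_compose[OF S])
        show "(map_of_chart d \<circ> inv_chart e) ` ?S \<subseteq> map_of_chart d ` (dom_of d \<inter> dom_of c)"
          using inv_chart_map[OF e] by auto
        show "Ck_on k ?S (map_of_chart d \<circ> inv_chart e)"
          using transition_smooth[OF e d] unfolding smooth_on_def
          by (blast intro: Ck_on_subset)
        show "Ck_on k (map_of_chart d ` (dom_of d \<inter> dom_of c)) ?F"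
          using smooth_on_frechet[OF transition_smooth[OF d c]] unfolding smooth_on_def by blast
      qed
    qed
    moreover have "(?F \<circ> (map_of_chart d \<circ> inv_chart e)) x
        = ((\<lambda>q. coords (coord_field M d b q) c) \<circ> inv_chart e) x" if "x \<in> ?S" for x
      using that by (auto simp: inv_chart_map[OF e] coords_coord_field[OF c])
    moreover have "{q \<in> dom_of d. q \<in> dom_of c} = dom_of d \<inter> dom_of c" by blast
    ultimately show ?thesis
      using smooth_on_cong[OF S, of "?F \<circ> (map_of_chart d \<circ> inv_chart e)"
          "(\<lambda>q. coords (coord_field M d b q) c) \<circ> inv_chart e"] by presburger
  qed
  then show ?thesis
    unfolding vfields_along_def smooth_fun_on_def using coord_field_tangent[OF d] by blast
qed

lemma coord_field_eq:
  assumes "d \<in> atlas M" "q \<in> dom_of d" "v \<in> tangent_space M q"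
  shows "coord_field M d (coords v d) q = v"
  using assms coord_field_tangent coords_coord_field_same by (metis tangent_eqI)

lemma coord_field_linear:
  assumes "d \<in> atlas M" "q \<in> dom_of d"
  shows "linear (\<lambda>b. coord_field M d b q)"
proof (rule linearI)
  show "coord_field M d (b + b') q = coord_field M d b q + coord_field M d b' q" for b b'
    by (rule tangent_eqI[OF _ _ assms])
      (auto intro: coord_field_tangent assms tangent_add simp: coords_coord_field_same assms)
  show "coord_field M d (r *\<^sub>R b) q = r *\<^sub>R coord_field M d b q" for r b
    by (rule tangent_eqI[OF _ _ assms])
      (auto intro: coord_field_tangent assms tangent_scale simp: coords_coord_field_same assms)
qed

section \<open>Local vector fields, tensor fields and metrics\<close>

lemma vfields_onD:
  assumes "Y \<in> vfields_on M W"
  shows "p \<in> W \<Longrightarrow> Y p \<in> tangent_space M p"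
    and "d \<in> atlas M \<Longrightarrow> smooth_fun_on M (W \<inter> dom_of d) (\<lambda>q. coords (Y q) d)"
  using assms unfolding vfields_along_def Int_def by blast+

lemma vfields_onI:
  assumes "\<And>p. p \<in> W \<Longrightarrow> Y p \<in> tangent_space M p"
    and "\<And>d. d \<in> atlas M \<Longrightarrow> smooth_fun_on M (W \<inter> dom_of d) (\<lambda>q. coords (Y q) d)"
  shows "Y \<in> vfields_on M W"
  using assms unfolding vfields_along_def Int_def by blast

lemma vfields_on_add:
  assumes "open_in M W" "Y \<in> vfields_on M W" "Z \<in> vfields_on M W"
  shows "(\<lambda>q. Y q + Z q) \<in> vfields_on M W"
proof (rule vfields_onI)
  show "Y p + Z p \<in> tangent_space M p" if "p \<in> W" for p
    using that by (intro tangent_add vfields_onD(1)[OF assms(2)] vfields_onD(1)[OF assms(3)])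
  show "smooth_fun_on M (W \<inter> dom_of d) (\<lambda>q. coords (Y q + Z q) d)" if "d \<in> atlas M" for d
    unfolding coords_simps using that
    by (intro smooth_fun_on_add openin_Int open_dom assms(1) vfields_onD(2)[OF assms(2)]
        vfields_onD(2)[OF assms(3)])
qed

lemma vfields_on_scaleR:
  assumes "open_in M W" "smooth_fun_on M W f" "Y \<in> vfields_on M W"
  shows "(\<lambda>q. f q *\<^sub>R Y q) \<in> vfields_on M W"
proof (rule vfields_onI)
  show "f p *\<^sub>R Y p \<in> tangent_space M p" if "p \<in> W" for p
    using that by (intro tangent_scale vfields_onD(1)[OF assms(3)])
  show "smooth_fun_on M (W \<inter> dom_of d) (\<lambda>q. coords (f q *\<^sub>R Y q) d)" if "d \<in> atlas M" for d
    unfolding coords_simps using that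
    by (intro smooth_fun_on_scaleR openin_Int open_dom assms(1) vfields_onD(2)[OF assms(3)]
        smooth_fun_on_subset[OF assms(2)]) auto
qed

lemma vfields_on_sum:
  assumes W: "open_in M W" and "\<And>i. i \<in> I \<Longrightarrow> Y i \<in> vfields_on M W"
  shows "(\<lambda>q. \<Sum>i\<in>I. Y i q) \<in> vfields_on M W"
  using assms(2)
  by (induction I rule: infinite_finite_induct)
    (auto intro!: vfields_on_add W intro: vfields_onI tangent_0 smooth_fun_on_const)

lemma
  assumes "tensor11 M Q" "q \<in> points M"
  shows tensor11_tangent: "v \<in> tangent_space M q \<Longrightarrow> Q q v \<in> tangent_space M q"
    and tensor11_linear_over: "linear_over (tangent_space M q) (Q q)"
  using assms unfolding tensor11_def by blast+

lemma tensor11_vfields: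
  "tensor11 M Q \<Longrightarrow> open_in M W \<Longrightarrow> X \<in> vfields_on M W \<Longrightarrow> (\<lambda>p. Q p (X p)) \<in> vfields_on M W"
  unfolding tensor11_def by blast

lemma
  assumes "riemannian_metric M g" "q \<in> points M" "v \<in> tangent_space M q"
  shows metric_linear_right: "linear_over (tangent_space M q) (g q v)"
    and metric_linear_left: "linear_over (tangent_space M q) (\<lambda>w. g q w v)"
    and metric_sym: "w \<in> tangent_space M q \<Longrightarrow> g q v w = g q w v"
  using assms unfolding riemannian_metric_def tensor02_def by blast+

lemma metric_smooth:
  assumes "riemannian_metric M g" "open_in M W" "X \<in> vfields_on M W" "Y \<in> vfields_on M W"
  shows "smooth_fun_on M W (\<lambda>p. g p (X p) (Y p))"
  using assms unfolding riemannian_metric_def tensor02_def by blast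

lemma metric_sum:
  assumes g: "riemannian_metric M g" and q: "q \<in> points M"
    and X: "\<And>i. i \<in> I \<Longrightarrow> X i \<in> tangent_space M q" and Y: "\<And>j. j \<in> J \<Longrightarrow> Y j \<in> tangent_space M q"
  shows "g q (\<Sum>i\<in>I. X i) (\<Sum>j\<in>J. Y j) = (\<Sum>i\<in>I. \<Sum>j\<in>J. g q (X i) (Y j))"
proof -
  have "g q (\<Sum>i\<in>I. X i) (\<Sum>j\<in>J. Y j) = (\<Sum>i\<in>I. g q (X i) (\<Sum>j\<in>J. Y j))"
    using linear_over_sum[OF subspace_tangent metric_linear_left[OF g q tangent_sum[OF Y]] X,
        where c = "\<lambda>_. 1"] by simp
  also have "\<dots> = (\<Sum>i\<in>I. \<Sum>j\<in>J. g q (X i) (Y j))"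
    using linear_over_sum[OF subspace_tangent metric_linear_right[OF g q X] Y, where c = "\<lambda>_. 1"]
    by (intro sum.cong) simp_all
  finally show ?thesis .
qed

end

section \<open>Affine connections and fields along a map\<close>

locale connection_mfd = smooth_mfd +
  fixes D
  assumes conn: "affine_connection M D"
begin

lemma
  assumes "open_in M W" "Y \<in> vfields_on M W" "p \<in> W"
  shows D_tangent: "v \<in> tangent_space M p \<Longrightarrow> D p v Y \<in> tangent_space M p"
    and D_scaleR: "smooth_fun_on M W f \<Longrightarrow> v \<in> tangent_space M p \<Longrightarrow>
      D p v (\<lambda>q. f q *\<^sub>R Y q) = vderiv M p v f *\<^sub>R Y p + f p *\<^sub>R D p v Y"
    and D_cong: "Z \<in> vfields_on M W \<Longrightarrow> (\<And>q. q \<in> W \<Longrightarrow> Y q = Z q) \<Longrightarrow> v \<in> tangent_space M p \<Longrightarrow>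
      D p v Y = D p v Z"
    and D_add: "Z \<in> vfields_on M W \<Longrightarrow> v \<in> tangent_space M p \<Longrightarrow>
      D p v (\<lambda>q. Y q + Z q) = D p v Y + D p v Z"
proof -
  note c = mp[OF spec[OF conn[unfolded affine_connection_def], of W] assms(1)]
  show "v \<in> tangent_space M p \<Longrightarrow> D p v Y \<in> tangent_space M p"
    using c[THEN conjunct2, THEN conjunct2, THEN conjunct1] assms(2,3) by auto
  show "smooth_fun_on M W f \<Longrightarrow> v \<in> tangent_space M p \<Longrightarrow>
      D p v (\<lambda>q. f q *\<^sub>R Y q) = vderiv M p v f *\<^sub>R Y p + f p *\<^sub>R D p v Y"
    using c[THEN conjunct2, THEN conjunct2, THEN conjunct2, THEN conjunct2] assms(2,3) by simp
  show "Z \<in> vfields_on M W \<Longrightarrow> (\<And>q. q \<in> W \<Longrightarrow> Y q = Z q) \<Longrightarrow> v \<in> tangent_space M p \<Longrightarrow>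
      D p v Y = D p v Z"
    by (rule c[THEN conjunct2, THEN conjunct1, rule_format, OF assms(2) _ assms(3)]) auto
  show "Z \<in> vfields_on M W \<Longrightarrow> v \<in> tangent_space M p \<Longrightarrow>
      D p v (\<lambda>q. Y q + Z q) = D p v Y + D p v Z"
    using c[THEN conjunct2, THEN conjunct2, THEN conjunct2, THEN conjunct1] assms(2,3) by simp
qed

lemma D_sum:
  assumes W: "open_in M W" and "\<And>i. i \<in> I \<Longrightarrow> Y i \<in> vfields_on M W"
    "\<And>i. i \<in> I \<Longrightarrow> smooth_fun_on M W (f i)" and p: "p \<in> W" and v: "v \<in> tangent_space M p"
  shows "D p v (\<lambda>q. \<Sum>i\<in>I. f i q *\<^sub>R Y i q)
    = (\<Sum>i\<in>I. vderiv M p v (f i) *\<^sub>R Y i p + f i p *\<^sub>R D p v (Y i))"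
proof -
  \<comment> \<open>Empty sum: the zero field is the constant function 0 times itself, and the
    Leibniz rule then makes both terms vanish.\<close>
  have 0: "D p v (\<lambda>q. 0) = 0"
  proof -
    have "(\<lambda>q. 0) \<in> vfields_on M W" by (auto intro: vfields_onI tangent_0 smooth_fun_on_const)
    from D_scaleR[OF W this p smooth_fun_on_const[of _ 0] v] show ?thesis
      by (simp add: vderiv_const)
  qed
  show ?thesis
    using assms(2,3)
  proof (induction I rule: infinite_finite_induct)
    case (insert i I)
    have "D p v (\<lambda>q. f i q *\<^sub>R Y i q + (\<Sum>i\<in>I. f i q *\<^sub>R Y i q))
        = D p v (\<lambda>q. f i q *\<^sub>R Y i q) + D p v (\<lambda>q. \<Sum>i\<in>I. f i q *\<^sub>R Y i q)"
      using insert.prems by (intro D_add[OF W _ p _ v] vfields_on_sum vfields_on_scaleR W) auto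
    also have "D p v (\<lambda>q. f i q *\<^sub>R Y i q) = vderiv M p v (f i) *\<^sub>R Y i p + f i p *\<^sub>R D p v (Y i)"
      using insert.prems by (intro D_scaleR[OF W _ p _ v]) auto
    also have "D p v (\<lambda>q. \<Sum>i\<in>I. f i q *\<^sub>R Y i q)
        = (\<Sum>i\<in>I. vderiv M p v (f i) *\<^sub>R Y i p + f i p *\<^sub>R D p v (Y i))"
      using insert by blast
    finally show ?case using insert.hyps by simp
  qed (simp_all add: 0)
qed

lemma D_coord_field_tangent:
  assumes "d \<in> atlas M" "x \<in> dom_of d" "w \<in> tangent_space M x"
  shows "D x w (coord_field M d b) \<in> tangent_space M x"
  using D_tangent[OF open_dom coord_field_vfields] assms by blast

text \<open>Leibniz rule for the expansion of \<open>Y\<close> in the coordinate fields of \<open>d\<close>.\<close>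

lemma D_expand:
  assumes d: "d \<in> atlas M" and x: "x \<in> dom_of d" and w: "w \<in> tangent_space M x"
    and Y: "Y \<in> vfields_on M (dom_of d)"
  shows "D x w Y = (\<Sum>b\<in>Basis. (vderiv M x w (\<lambda>q. coords (Y q) d) \<bullet> b) *\<^sub>R coord_field M d b x
      + (coords (Y x) d \<bullet> b) *\<^sub>R D x w (coord_field M d b))"
proof -
  have s: "smooth_fun_on M (dom_of d) (\<lambda>q. coords (Y q) d)"
    using vfields_onD(2)[OF Y d] by simp
  have si: "smooth_fun_on M (dom_of d) (\<lambda>q. coords (Y q) d \<bullet> b)" for b
    by (rule smooth_fun_on_inner[OF open_dom[OF d] s])
  have m: "mdiff M x (\<lambda>q. coords (Y q) d)"
    by (rule smooth_fun_on_imp_mdiff[OF s x dom_subset[OF d x]])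
  \<comment> \<open>Outside \<open>dom_of d\<close> the field and its expansion may differ as total
    functions, so the locality axiom of the connection is what permits the replacement.\<close>
  have "D x w Y = D x w (\<lambda>q. \<Sum>b\<in>Basis. (coords (Y q) d \<bullet> b) *\<^sub>R coord_field M d b q)"
  proof (rule D_cong[OF open_dom[OF d] Y x _ _ w])
    show "(\<lambda>q. \<Sum>b\<in>Basis. (coords (Y q) d \<bullet> b) *\<^sub>R coord_field M d b q) \<in> vfields_on M (dom_of d)"
      by (intro vfields_on_sum vfields_on_scaleR open_dom d si coord_field_vfields)
    show "Y q = (\<Sum>b\<in>Basis. (coords (Y q) d \<bullet> b) *\<^sub>R coord_field M d b q)" if "q \<in> dom_of d" for q
      using linear_eq_sum_Basis[OF coord_field_linear[OF d that], of "coords (Y q) d"]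
        coord_field_eq[OF d that vfields_onD(1)[OF Y that]] by simp
  qed
  also have "\<dots> = (\<Sum>b\<in>Basis. (vderiv M x w (\<lambda>q. coords (Y q) d) \<bullet> b) *\<^sub>R coord_field M d b x
      + (coords (Y x) d \<bullet> b) *\<^sub>R D x w (coord_field M d b))"
    by (subst D_sum[OF open_dom[OF d] coord_field_vfields[OF d] si x w])
      (simp add: vderiv_inner[OF m])
  finally show ?thesis .
qed

text \<open>A coordinate field has constant components in its own chart, so the differentiated
  coefficients drop out of \<open>D_expand\<close>. What remains is the Christoffel term, linear in
  the coefficient vector.\<close>

lemma D_coord_field_linear:
  assumes d: "d \<in> atlas M" and x: "x \<in> dom_of d" and w: "w \<in> tangent_space M x"
  shows "D x w (coord_field M d v) = (\<Sum>b\<in>Basis. (v \<bullet> b) *\<^sub>R D x w (coord_field M d b))"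
proof -
  have "vderiv M x w (\<lambda>q. coords (coord_field M d v q) d) = vderiv M x w (\<lambda>q. v)"
    by (rule vderiv_cong[OF x open_dom[OF d]]) (rule coords_coord_field_same[OF d])
  then show ?thesis
    using D_expand[OF d x w coord_field_vfields[OF d, of v]]
    by (simp add: coords_coord_field_same[OF d x] vderiv_const)
qed

text \<open>Derivative of the components plus Christoffel term, with the coefficients of
  \<open>Y\<close> frozen at \<open>x\<close>. \<open>cov_along\<close> is defined by the same shape
  of expression, which makes the derivative of ambient fields comparable with the one along a
  map.\<close>

lemma coords_D:
  assumes d: "d \<in> atlas M" and x: "x \<in> dom_of d" and w: "w \<in> tangent_space M x"
    and Y: "Y \<in> vfields_on M (dom_of d)"
  shows "coords (D x w Y) d = vderiv M x w (\<lambda>q. coords (Y q) d)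
    + coords (D x w (coord_field M d (coords (Y x) d))) d"
  by (simp add: D_expand[OF assms] D_coord_field_linear[OF d x w, of "coords (Y x) d"] sum.distrib
      coords_coord_field_same[OF d x] euclidean_representation)

text \<open>Parallelism asks for a field in the direction slot; the coordinate field with
  coefficients \<open>coords w d\<close> takes the value \<open>w\<close> at
  \<open>x\<close>.\<close>

lemma parallel_coord_field:
  assumes "parallel11 M D Q" and Q: "tensor11 M Q" and d: "d \<in> atlas M" "x \<in> dom_of d"
    and w: "w \<in> tangent_space M x"
  shows "D x w (\<lambda>y. Q y (coord_field M d b y)) = Q x (D x w (coord_field M d b))"
proof -
  have "cov_tensor11 D Q (coord_field M d (coords w d)) (coord_field M d b) x = 0"
    using assms(1) open_dom[OF d(1)] coord_field_vfields[OF d(1)] d(2)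
    unfolding parallel11_def by blast
  then show ?thesis by (simp add: cov_tensor11_def coord_field_eq[OF d w])
qed

lemma levi_civita_metric:
  assumes "levi_civita M g D" "open_in M W" "Y \<in> vfields_on M W" "Z \<in> vfields_on M W"
    "p \<in> W" "v \<in> tangent_space M p"
  shows "vderiv M p v (\<lambda>q. g q (Y q) (Z q)) = g p (D p v Y) (Z p) + g p (Y p) (D p v Z)"
  using mp[OF spec[OF conjunct2[OF assms(1)[unfolded levi_civita_def]], of W] assms(2),
      THEN conjunct2, rule_format, OF assms(3-6)] .

end

text \<open>Differentiability is demanded at \<open>p\<close> only, as much as one covariant
  derivative consumes. Tangency is demanded at all points, because the expansion in coordinate
  fields must hold in a neighbourhood before it can be differentiated.\<close>

definition diff_along :: "('a, 'e::euclidean_space) manifold \<Rightarrow> ('b, 'f::euclidean_space) manifold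
    \<Rightarrow> ('a \<Rightarrow> 'b) \<Rightarrow> 'a \<Rightarrow> ('a \<Rightarrow> ('b, 'f) tvec) \<Rightarrow> bool" where
  "diff_along M N \<phi> p V \<longleftrightarrow> (\<forall>q\<in>points M. V q \<in> tangent_space N (\<phi> q)) \<and>
     (\<forall>d\<in>atlas N. \<phi> p \<in> dom_of d \<longrightarrow> mdiff M p (\<lambda>q. coords (V q) d))"

locale map_to_connection_mfd = M: smooth_mfd M + N: connection_mfd N D
  for M :: "('a, 'e::euclidean_space) manifold" and N :: "('b, 'f::euclidean_space) manifold" and D +
  fixes \<phi> :: "'a \<Rightarrow> 'b"
  assumes smooth: "smooth_map M N \<phi>"
begin

section \<open>The pushforward and differentiation of functions composed with the map\<close>

abbreviation "pf \<equiv> pushforward M N \<phi>"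
abbreviation "cov \<equiv> cov_along M N \<phi> D"

lemma phi_points: "p \<in> points M \<Longrightarrow> \<phi> p \<in> points N"
  using smooth unfolding smooth_map_def by (auto simp: continuous_map_def)

lemma open_preimage: "open_in N U \<Longrightarrow> open_in M {p \<in> points M. \<phi> p \<in> U}"
  using smooth unfolding smooth_map_def by (intro openin_continuous_map_preimage) auto

lemma smooth_chart_phi:
  "d \<in> atlas N \<Longrightarrow> smooth_fun_on M {p \<in> points M. \<phi> p \<in> dom_of d} (map_of_chart d \<circ> \<phi>)"
  using smooth unfolding smooth_map_def by blast

lemma mdiff_chart_phi:
  assumes "p \<in> points M" "d \<in> atlas N" "\<phi> p \<in> dom_of d"
  shows "mdiff M p (\<lambda>q. map_of_chart d (\<phi> q))"
  using M.smooth_fun_on_imp_mdiff[OF smooth_chart_phi[OF assms(2)]] assms by (simp add: o_def)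

lemma coords_pf:
  "d \<in> atlas N \<Longrightarrow> \<phi> p \<in> dom_of d \<Longrightarrow> coords (pf p v) d = vderiv M p v (\<lambda>q. map_of_chart d (\<phi> q))"
  by (simp add: pushforward_def o_def)

text \<open>Near \<open>p\<close> the function factors through the chart \<open>d\<close>, and the
  derivative of the inner factor \<open>map_of_chart d \<circ> \<phi>\<close> along \<open>v\<close>
  is the coordinate vector of the pushforward in \<open>d\<close>.\<close>

lemma
  assumes p: "p \<in> points M" "d \<in> atlas N" "\<phi> p \<in> dom_of d"
    and F: "(F \<circ> inv_chart d) differentiable (at (map_of_chart d (\<phi> p)))"
  shows mdiff_phi: "mdiff M p (\<lambda>q. F (\<phi> q))"
    and vderiv_phi: "vderiv M p v (\<lambda>q. F (\<phi> q))
      = frechet_derivative (F \<circ> inv_chart d) (at (map_of_chart d (\<phi> p))) (coords (pf p v) d)"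
proof -
  let ?U = "{q \<in> points M. \<phi> q \<in> dom_of d}"
  have U: "p \<in> ?U" "open_in M ?U" using p open_preimage[OF N.open_dom] by auto
  have eq: "(F \<circ> inv_chart d) (map_of_chart d (\<phi> q)) = F (\<phi> q)" if "q \<in> ?U" for q
    using that p by (simp add: N.inv_chart_map)
  show "mdiff M p (\<lambda>q. F (\<phi> q))"
    by (rule iffD1[OF M.mdiff_cong[OF U eq] M.mdiff_compose[OF p(1) mdiff_chart_phi[OF p] F]])
  show "vderiv M p v (\<lambda>q. F (\<phi> q))
      = frechet_derivative (F \<circ> inv_chart d) (at (map_of_chart d (\<phi> p))) (coords (pf p v) d)"
    unfolding coords_pf[OF p(2,3)] M.vderiv_compose[OF p(1) mdiff_chart_phi[OF p] F, symmetric]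
    by (rule M.vderiv_cong[OF U eq, symmetric])
qed

text \<open>Taking the map of a second chart for \<open>F\<close> in \<open>vderiv_phi\<close> turns
  the chain rule into the transformation law.\<close>

lemma pf_tangent:
  assumes p: "p \<in> points M"
  shows "pf p v \<in> tangent_space N (\<phi> p)"
proof (rule N.tangentI)
  show "coords (pf p v) d = frechet_derivative (map_of_chart d \<circ> inv_chart c)
      (at (map_of_chart c (\<phi> p))) (coords (pf p v) c)"
    if "c \<in> atlas N" "d \<in> atlas N" "\<phi> p \<in> dom_of c" "\<phi> p \<in> dom_of d" for c d
    using vderiv_phi[OF p that(1,3) N.transition_differentiable[OF that], of v]
    by (simp only: coords_pf[OF that(2,4)])
qed (auto simp: pushforward_def)

lemma
  assumes p: "p \<in> points M" "\<phi> p \<in> W" and F: "smooth_fun_on N W F"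
  shows mdiff_comp_phi: "mdiff M p (\<lambda>q. F (\<phi> q))"
    and vderiv_comp_phi: "vderiv M p v (\<lambda>q. F (\<phi> q)) = vderiv N (\<phi> p) (pf p v) F"
proof -
  note c = N.chart_at[OF phi_points[OF p(1)]]
  have d: "(F \<circ> inv_chart (chart_at N (\<phi> p))) differentiable
      (at (map_of_chart (chart_at N (\<phi> p)) (\<phi> p)))"
    using N.smooth_fun_on_imp_mdiff[OF F p(2) phi_points[OF p(1)]] unfolding mdiff_def .
  show "mdiff M p (\<lambda>q. F (\<phi> q))" by (rule mdiff_phi[OF p(1) c d])
  show "vderiv M p v (\<lambda>q. F (\<phi> q)) = vderiv N (\<phi> p) (pf p v) F"
    using vderiv_phi[OF p(1) c d, of v] by (simp only: vderiv_def[of N])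
qed

text \<open>The set \<open>T\<close> is arbitrary because \<open>vderiv\<close> reads only the
  coordinates of \<open>v\<close> in \<open>chart_at M p\<close>; hence \<open>pf p\<close> is
  linear on the whole type of coordinate assignments.\<close>

lemma pf_linear_over: "p \<in> points M \<Longrightarrow> linear_over T (pf p)"
  unfolding linear_over_def
  by (intro ballI allI tvec_eqI)
    (auto simp: pushforward_def o_def intro!: vderiv_tangent_linear mdiff_chart_phi)

lemma pf_linear: "p \<in> points M \<Longrightarrow> linear (pf p)"
  using linear_over_scale[OF subspace_UNIV pf_linear_over] linear_over_add[OF subspace_UNIV pf_linear_over]
  by (intro linearI) auto

lemma diff_along_tangent: "diff_along M N \<phi> p V \<Longrightarrow> q \<in> points M \<Longrightarrow> V q \<in> tangent_space N (\<phi> q)"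
  unfolding diff_along_def by blast

lemma diff_along_mdiff:
  "diff_along M N \<phi> p V \<Longrightarrow> d \<in> atlas N \<Longrightarrow> \<phi> p \<in> dom_of d \<Longrightarrow> mdiff M p (\<lambda>q. coords (V q) d)"
  unfolding diff_along_def by blast

lemma vfields_along_diff:
  assumes "V \<in> vfields_along M N \<phi> (points M)" "p \<in> points M"
  shows "diff_along M N \<phi> p V"
  using assms M.smooth_fun_on_imp_mdiff unfolding vfields_along_def diff_along_def by blast

text \<open>The pushforward at \<open>q\<close> is defined through \<open>chart_at M q\<close>,
  which need not vary nicely with \<open>q\<close>. Near \<open>p\<close> it is rewritten in the
  fixed chart \<open>c\<close> as the derivative of the coordinate representation \<open>F\<close>
  of \<phi>, applied to the components of \<open>Y\<close>; after expansion in \<open>Basis\<close>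
  this is a sum of products of differentiable functions, by smoothness of \<open>F\<close>.\<close>

lemma pf_diff_along:
  assumes Y: "Y \<in> vfields M" and p: "p \<in> points M"
  shows "diff_along M N \<phi> p (\<lambda>q. pf q (Y q))"
  unfolding diff_along_def
proof (intro conjI ballI impI)
  show "pf q (Y q) \<in> tangent_space N (\<phi> q)" if "q \<in> points M" for q
    using pf_tangent that .
  fix d assume d: "d \<in> atlas N" "\<phi> p \<in> dom_of d"
  define c where "c = chart_at M p"
  have c: "c \<in> atlas M" "p \<in> dom_of c" using M.chart_at[OF p] unfolding c_def by auto
  define F where "F = (map_of_chart d \<circ> \<phi>) \<circ> inv_chart c"
  let ?W = "{q \<in> points M. \<phi> q \<in> dom_of d}"
  let ?U = "dom_of c \<inter> ?W"
  have U: "p \<in> ?U" "open_in M ?U"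
    using c d p open_preimage[OF N.open_dom[OF d(1)]] M.open_dom[OF c(1)] by auto
  have sF: "smooth_on (map_of_chart c ` ?U) F"
    using smooth_chart_phi[OF d(1)] c(1) unfolding smooth_fun_on_def F_def by blast
  have dF: "F differentiable (at (map_of_chart c q))" if "q \<in> ?U" for q
    using smooth_on_imp_differentiable[OF sF] that by blast
  have eq: "(\<Sum>b\<in>Basis. (coords (Y q) c \<bullet> b) *\<^sub>R frechet_derivative F (at (map_of_chart c q)) b)
      = coords (pf q (Y q)) d" if q: "q \<in> ?U" for q
  proof -
    have "coords (pf q (Y q)) d = vderiv M q (Y q) (map_of_chart d \<circ> \<phi>)"
      using coords_pf d q by (simp add: o_def)
    also have "\<dots> = frechet_derivative F (at (map_of_chart c q)) (coords (Y q) c)"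
      using dF[OF q] q M.vfields_onD(1)[OF Y] unfolding F_def
      by (intro M.vderiv_chart c) auto
    finally show ?thesis
      using linear_eq_sum_Basis[OF linear_frechet_derivative[OF dF[OF q]], of "coords (Y q) c"] by simp
  qed
  have "mdiff M p (\<lambda>q. coords (Y q) c)"
    by (rule M.smooth_fun_on_imp_mdiff[OF M.vfields_onD(2)[OF Y c(1)] _ p]) (use c(2) p in simp)
  \<comment> \<open>In every chart of the atlas, the map of \<open>c\<close> is represented by a
    smooth transition map.\<close>
  moreover have "mdiff M p (map_of_chart c)"
    by (rule M.smooth_fun_on_imp_mdiff[OF _ c(2) p])
      (use M.transition_smooth[OF _ c(1)] in \<open>auto simp: smooth_fun_on_def\<close>)
  moreover have "(\<lambda>x. frechet_derivative F (at x) b) differentiable (at (map_of_chart c p))" for b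
    using smooth_on_imp_differentiable[OF smooth_on_frechet[OF sF]] U by blast
  ultimately have "mdiff M p (\<lambda>q. \<Sum>b\<in>Basis. (coords (Y q) c \<bullet> b)
      *\<^sub>R frechet_derivative F (at (map_of_chart c q)) b)"
    using M.mdiff_compose[OF p, of "map_of_chart c" "\<lambda>x. frechet_derivative F (at x) _"]
    by (intro mdiff_sum M.mdiff_scaleR[OF p] mdiff_inner) blast+
  then show "mdiff M p (\<lambda>q. coords (pf q (Y q)) d)"
    by (rule iffD1[OF M.mdiff_cong[OF U], rotated]) (rule eq)
qed

section \<open>Algebra of fields along the map and of their covariant derivative\<close>

lemma diff_along_add:
  "diff_along M N \<phi> p V \<Longrightarrow> diff_along M N \<phi> p W \<Longrightarrow> diff_along M N \<phi> p (\<lambda>q. V q + W q)"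
  unfolding diff_along_def by (simp add: N.tangent_add mdiff_add)

lemma diff_along_scaleR:
  "p \<in> points M \<Longrightarrow> diff_along M N \<phi> p V \<Longrightarrow> mdiff M p f \<Longrightarrow> diff_along M N \<phi> p (\<lambda>q. f q *\<^sub>R V q)"
  unfolding diff_along_def by (simp add: N.tangent_scale M.mdiff_scaleR)

lemma diff_along_sum:
  "(\<And>i. i \<in> I \<Longrightarrow> diff_along M N \<phi> p (V i)) \<Longrightarrow> diff_along M N \<phi> p (\<lambda>q. \<Sum>i\<in>I. V i q)"
  by (induction I rule: infinite_finite_induct)
    (auto simp: diff_along_add, auto simp: diff_along_def N.tangent_0 mdiff_const)

lemma coords_cov:
  "d \<in> atlas N \<Longrightarrow> \<phi> p \<in> dom_of d \<Longrightarrow> coords (cov p v V) d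
    = vderiv M p v (\<lambda>q. coords (V q) d) + coords (D (\<phi> p) (pf p v) (coord_field N d (coords (V p) d))) d"
  by (simp add: cov_along_def)

lemma coords_cov_0: "\<not> (d \<in> atlas N \<and> \<phi> p \<in> dom_of d) \<Longrightarrow> coords (cov p v V) d = 0"
  by (auto simp: cov_along_def)

lemma D_phi_linear:
  assumes "p \<in> points M" "d \<in> atlas N" "\<phi> p \<in> dom_of d"
  shows "linear (\<lambda>b. D (\<phi> p) (pf p v) (coord_field N d b))"
proof -
  have *: "D (\<phi> p) (pf p v) (coord_field N d b)
      = (\<Sum>i\<in>Basis. (b \<bullet> i) *\<^sub>R D (\<phi> p) (pf p v) (coord_field N d i))" for b
    by (rule N.D_coord_field_linear[OF assms(2,3) pf_tangent[OF assms(1)]])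
  show ?thesis
    by (subst *, rule linearI)
      (simp_all add: inner_left_distrib scaleR_left_distrib sum.distrib scaleR_sum_right)
qed

lemma cov_cong:
  assumes "p \<in> points M" "\<And>q. q \<in> points M \<Longrightarrow> V q = W q"
  shows "cov p v V = cov p v W"
proof (rule tvec_eqI)
  show "coords (cov p v V) d = coords (cov p v W) d" for d
    using M.vderiv_cong[OF assms(1) openin_topspace, of "\<lambda>q. coords (V q) d" "\<lambda>q. coords (W q) d"] assms
    by (cases "d \<in> atlas N \<and> \<phi> p \<in> dom_of d") (auto simp: coords_cov coords_cov_0)
qed

lemma cov_add:
  assumes "p \<in> points M" "diff_along M N \<phi> p V" "diff_along M N \<phi> p W"
  shows "cov p v (\<lambda>q. V q + W q) = cov p v V + cov p v W"
proof (rule tvec_eqI)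
  show "coords (cov p v (\<lambda>q. V q + W q)) d = coords (cov p v V + cov p v W) d" for d
    using vderiv_add[OF diff_along_mdiff[OF assms(2)] diff_along_mdiff[OF assms(3)]]
      linear_add[OF D_phi_linear[OF assms(1)]]
    by (cases "d \<in> atlas N \<and> \<phi> p \<in> dom_of d") (auto simp: coords_cov coords_cov_0)
qed

lemma cov_scaleR:
  assumes "p \<in> points M" "diff_along M N \<phi> p V" "mdiff M p f"
  shows "cov p v (\<lambda>q. f q *\<^sub>R V q) = vderiv M p v f *\<^sub>R V p + f p *\<^sub>R cov p v V"
proof (rule tvec_eqI)
  show "coords (cov p v (\<lambda>q. f q *\<^sub>R V q)) d
      = coords (vderiv M p v f *\<^sub>R V p + f p *\<^sub>R cov p v V) d" for d
    using M.vderiv_scaleR[OF assms(1,3) diff_along_mdiff[OF assms(2)]]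
      linear_scale[OF D_phi_linear[OF assms(1)]]
      N.tangent_coords_0[OF diff_along_tangent[OF assms(2,1)], of d]
    by (cases "d \<in> atlas N \<and> \<phi> p \<in> dom_of d") (auto simp: coords_cov coords_cov_0 algebra_simps)
qed

lemma cov_0: "p \<in> points M \<Longrightarrow> cov p v (\<lambda>q. 0) = 0"
  by (rule tvec_eqI) (auto simp: cov_along_def vderiv_const linear_0[OF D_phi_linear])

lemma cov_sum:
  assumes p: "p \<in> points M" and "\<And>i. i \<in> I \<Longrightarrow> diff_along M N \<phi> p (V i)"
    "\<And>i. i \<in> I \<Longrightarrow> mdiff M p (f i)"
  shows "cov p v (\<lambda>q. \<Sum>i\<in>I. f i q *\<^sub>R V i q)
    = (\<Sum>i\<in>I. vderiv M p v (f i) *\<^sub>R V i p + f i p *\<^sub>R cov p v (V i))"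
  using assms(2,3)
proof (induction I rule: infinite_finite_induct)
  case (insert i I)
  have "cov p v (\<lambda>q. f i q *\<^sub>R V i q + (\<Sum>i\<in>I. f i q *\<^sub>R V i q))
      = cov p v (\<lambda>q. f i q *\<^sub>R V i q) + cov p v (\<lambda>q. \<Sum>i\<in>I. f i q *\<^sub>R V i q)"
    using insert.prems p by (intro cov_add diff_along_sum diff_along_scaleR) auto
  then show ?case using insert cov_scaleR[OF p] by simp
qed (simp_all add: cov_0 p)

lemma diff_along_expand:
  assumes "diff_along M N \<phi> p V" "q \<in> points M" "d \<in> atlas N" "\<phi> q \<in> dom_of d"
  shows "V q = (\<Sum>b\<in>Basis. (coords (V q) d \<bullet> b) *\<^sub>R coord_field N d b (\<phi> q))"
  using linear_eq_sum_Basis[OF N.coord_field_linear[OF assms(3,4)], of "coords (V q) d"]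
    N.coord_field_eq[OF assms(3,4) diff_along_tangent[OF assms(1,2)]] by simp

text \<open>\<open>cov_along\<close> is assembled chart by chart, so the definition yields equality
  only of the coordinates in \<open>d\<close>. The premise \<open>T\<close> promotes it to an
  equality of vectors, as a tensor must be applied to the vector itself.\<close>

lemma cov_expand:
  assumes p: "p \<in> points M" and V: "diff_along M N \<phi> p V" and d: "d \<in> atlas N" "\<phi> p \<in> dom_of d"
    and T: "cov p v V \<in> tangent_space N (\<phi> p)"
  shows "cov p v V = (\<Sum>b\<in>Basis. (vderiv M p v (\<lambda>q. coords (V q) d) \<bullet> b) *\<^sub>R coord_field N d b (\<phi> p)
      + (coords (V p) d \<bullet> b) *\<^sub>R D (\<phi> p) (pf p v) (coord_field N d b))"
proof (rule N.tangent_eqI[OF T _ d])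
  show "(\<Sum>b\<in>Basis. (vderiv M p v (\<lambda>q. coords (V q) d) \<bullet> b) *\<^sub>R coord_field N d b (\<phi> p)
      + (coords (V p) d \<bullet> b) *\<^sub>R D (\<phi> p) (pf p v) (coord_field N d b)) \<in> tangent_space N (\<phi> p)"
    by (intro N.tangent_sum N.tangent_add N.tangent_scale N.coord_field_tangent
        N.D_coord_field_tangent pf_tangent d p)
  show "coords (cov p v V) d = coords (\<Sum>b\<in>Basis. (vderiv M p v (\<lambda>q. coords (V q) d) \<bullet> b)
      *\<^sub>R coord_field N d b (\<phi> p)
      + (coords (V p) d \<bullet> b) *\<^sub>R D (\<phi> p) (pf p v) (coord_field N d b)) d"
    by (simp add: coords_cov d sum.distrib N.coords_coord_field_same euclidean_representation
        linear_eq_sum_Basis[OF D_phi_linear[OF p d, of v], of "coords (V p) d"])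
qed

text \<open>With V = \<Sum> V_b E_b, linearity gives Q V = \<Sum> V_b Q(E_b). Differentiation hits
  either V_b, where \<open>Q\<close> is a spectator, or the ambient field Q(E_b), whose derivative
  is Q of the derivative of E_b. Tangency is asked only of the derivative of \<open>V\<close>; the
  left-hand side is compared in each chart separately.\<close>

lemma cov_parallel:
  assumes p: "p \<in> points M" and V: "diff_along M N \<phi> p V"
    and T: "cov p v V \<in> tangent_space N (\<phi> p)"
    and Q: "tensor11 N Q" and par: "parallel11 N D Q"
  shows "cov p v (\<lambda>q. Q (\<phi> q) (V q)) = Q (\<phi> p) (cov p v V)"
proof (rule tvec_eqI)
  fix d
  note x = phi_points[OF p]
  show "coords (cov p v (\<lambda>q. Q (\<phi> q) (V q))) d = coords (Q (\<phi> p) (cov p v V)) d"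
  proof (cases "d \<in> atlas N \<and> \<phi> p \<in> dom_of d")
    case False
    then show ?thesis
      using N.tangent_coords_0[OF N.tensor11_tangent[OF Q x T]] by (simp add: coords_cov_0)
  next
    case True
    then have d: "d \<in> atlas N" "\<phi> p \<in> dom_of d" by auto
    let ?E = "coord_field N d" and ?w = "pf p v"
    let ?F = "\<lambda>b y. Q y (?E b y)"
    let ?dV = "vderiv M p v (\<lambda>q. coords (V q) d)"
    let ?L = "\<lambda>b. coords (D (\<phi> p) ?w (?E b)) d"
    note w = pf_tangent[OF p, of v]
    have FV: "?F b \<in> vfields_on N (dom_of d)" for b
      by (rule N.tensor11_vfields[OF Q N.open_dom[OF d(1)] N.coord_field_vfields[OF d(1)]])
    have sF: "smooth_fun_on N (dom_of d) (\<lambda>y. coords (?F b y) d)" for b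
      using N.vfields_onD(2)[OF FV d(1)] by simp
    have U: "p \<in> {q \<in> points M. \<phi> q \<in> dom_of d}" "open_in M {q \<in> points M. \<phi> q \<in> dom_of d}"
      using d p open_preimage[OF N.open_dom] by auto
    have expand: "coords (Q (\<phi> q) (V q)) d
        = (\<Sum>b\<in>Basis. (coords (V q) d \<bullet> b) *\<^sub>R coords (?F b (\<phi> q)) d)"
      if "q \<in> {q \<in> points M. \<phi> q \<in> dom_of d}" for q
    proof -
      have q: "q \<in> points M" "\<phi> q \<in> dom_of d" using that by auto
      have "Q (\<phi> q) (V q) = (\<Sum>b\<in>Basis. (coords (V q) d \<bullet> b) *\<^sub>R ?F b (\<phi> q))"
        by (subst diff_along_expand[OF V q(1) d(1) q(2)])
          (rule linear_over_sum[OF N.subspace_tangent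
              N.tensor11_linear_over[OF Q phi_points[OF q(1)]] N.coord_field_tangent[OF d(1) q(2)]])
      then show ?thesis by simp
    qed
    note mV = mdiff_inner[OF diff_along_mdiff[OF V d]] and mF = mdiff_comp_phi[OF p d(2) sF]
    have "vderiv M p v (\<lambda>q. coords (Q (\<phi> q) (V q)) d)
        = vderiv M p v (\<lambda>q. \<Sum>b\<in>Basis. (coords (V q) d \<bullet> b) *\<^sub>R coords (?F b (\<phi> q)) d)"
      by (rule M.vderiv_cong[OF U expand])
    also have "\<dots> = (\<Sum>b\<in>Basis. (?dV \<bullet> b) *\<^sub>R coords (?F b (\<phi> p)) d
        + (coords (V p) d \<bullet> b) *\<^sub>R vderiv N (\<phi> p) ?w (\<lambda>y. coords (?F b y) d))"
      by (simp add: vderiv_sum M.mdiff_scaleR[OF p] M.vderiv_scaleR[OF p] mV mF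
          vderiv_inner[OF diff_along_mdiff[OF V d]] vderiv_comp_phi[OF p d(2) sF])
    finally have 1: "vderiv M p v (\<lambda>q. coords (Q (\<phi> q) (V q)) d)
        = (\<Sum>b\<in>Basis. (?dV \<bullet> b) *\<^sub>R coords (?F b (\<phi> p)) d
        + (coords (V p) d \<bullet> b) *\<^sub>R vderiv N (\<phi> p) ?w (\<lambda>y. coords (?F b y) d))" .
    have L: "linear ?L"
      using linear_compose[OF D_phi_linear[OF p d, of v] coords_linear[of d]] by (simp add: o_def)
    have 2: "?L (coords (Q (\<phi> p) (V p)) d)
        = (\<Sum>b\<in>Basis. (coords (V p) d \<bullet> b) *\<^sub>R ?L (coords (?F b (\<phi> p)) d))"
      by (subst expand[OF U(1)]) (simp add: linear_sum[OF L] linear_scale[OF L])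
    \<comment> \<open>Parallelism enters here: the derivative of the components of Q(E_b) and its
      Christoffel term combine to the ambient derivative of Q(E_b), from which \<open>Q\<close> can
      be pulled out.\<close>
    have 3: "vderiv N (\<phi> p) ?w (\<lambda>y. coords (?F b y) d) + ?L (coords (?F b (\<phi> p)) d)
        = coords (Q (\<phi> p) (D (\<phi> p) ?w (?E b))) d" for b
      using N.coords_D[OF d w FV] N.parallel_coord_field[OF par Q d w] by simp
    have "coords (cov p v (\<lambda>q. Q (\<phi> q) (V q))) d
        = (\<Sum>b\<in>Basis. (?dV \<bullet> b) *\<^sub>R coords (?F b (\<phi> p)) d
            + (coords (V p) d \<bullet> b) *\<^sub>R coords (Q (\<phi> p) (D (\<phi> p) ?w (?E b))) d)"
      unfolding coords_cov[OF d] 1 2 3[symmetric] by (simp add: sum.distrib scaleR_right_distrib)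
    also have "\<dots> = coords (Q (\<phi> p) (cov p v V)) d"
    proof -
      note lin = N.tensor11_linear_over[OF Q x]
        and ET = N.coord_field_tangent[OF d] and DT = N.D_coord_field_tangent[OF d w]
      have "Q (\<phi> p) (cov p v V) = (\<Sum>b\<in>Basis. (?dV \<bullet> b) *\<^sub>R ?F b (\<phi> p))
          + (\<Sum>b\<in>Basis. (coords (V p) d \<bullet> b) *\<^sub>R Q (\<phi> p) (D (\<phi> p) ?w (?E b)))"
        unfolding cov_expand[OF p V d T] sum.distrib
        by (subst linear_over_add[OF N.subspace_tangent lin])
          (auto intro!: N.tangent_sum N.tangent_scale ET DT
            simp: linear_over_sum[OF N.subspace_tangent lin] ET DT)
      then show ?thesis by (simp add: sum.distrib)
    qed
    finally show ?thesis .
  qed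
qed

text \<open>By bilinearity the function is a double sum of coefficients times the Gram functions
  \<open>?G b c\<close> of the coordinate fields. Those are functions on the ambient manifold, so
  compatibility of \<open>D\<close> with \<open>g\<close> differentiates them; the rest is the
  product rule for three factors.\<close>

lemma cov_metric:
  assumes p: "p \<in> points M" and V: "diff_along M N \<phi> p V" and W: "diff_along M N \<phi> p W"
    and TV: "cov p v V \<in> tangent_space N (\<phi> p)" and TW: "cov p v W \<in> tangent_space N (\<phi> p)"
    and g: "riemannian_metric N g" and lc: "levi_civita N g D"
  shows "vderiv M p v (\<lambda>q. g (\<phi> q) (V q) (W q))
    = g (\<phi> p) (cov p v V) (W p) + g (\<phi> p) (V p) (cov p v W)"
proof -
  note x = phi_points[OF p]
  define d where "d = chart_at N (\<phi> p)"
  have d: "d \<in> atlas N" "\<phi> p \<in> dom_of d" unfolding d_def using N.chart_at[OF x] by auto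
  note od = N.open_dom[OF d(1)] and EV = N.coord_field_vfields[OF d(1)]
  let ?E = "coord_field N d" and ?w = "pf p v"
  let ?DE = "\<lambda>b. D (\<phi> p) ?w (?E b)"
  let ?V = "\<lambda>b q. coords (V q) d \<bullet> b" and ?W = "\<lambda>b q. coords (W q) d \<bullet> b"
  let ?dV = "\<lambda>b. vderiv M p v (\<lambda>q. coords (V q) d) \<bullet> b"
  let ?dW = "\<lambda>b. vderiv M p v (\<lambda>q. coords (W q) d) \<bullet> b"
  let ?G = "\<lambda>b c y. g y (?E b y) (?E c y)"
  note w = pf_tangent[OF p, of v]
  have sG: "smooth_fun_on N (dom_of d) (?G b c)" for b c by (rule N.metric_smooth[OF g od EV EV])
  have dG: "vderiv N (\<phi> p) ?w (?G b c)
      = g (\<phi> p) (?DE b) (?E c (\<phi> p)) + g (\<phi> p) (?E b (\<phi> p)) (?DE c)" for b c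
    by (rule N.levi_civita_metric[OF lc od EV EV d(2) w])
  have U: "p \<in> {q \<in> points M. \<phi> q \<in> dom_of d}" "open_in M {q \<in> points M. \<phi> q \<in> dom_of d}"
    using d p open_preimage[OF od] by auto
  have sc: "g y (a *\<^sub>R s) t = a * g y s t" "g y s (a *\<^sub>R t) = a * g y s t"
      "t' \<in> tangent_space N y \<Longrightarrow> g y s (t + t') = g y s t + g y s t'"
      "t' \<in> tangent_space N y \<Longrightarrow> g y (t + t') s = g y t s + g y t' s"
    if "y \<in> points N" "s \<in> tangent_space N y" "t \<in> tangent_space N y" for y s t t' a
    using that linear_over_scale[OF N.subspace_tangent N.metric_linear_left[OF g that(1,3)] that(2)]
      linear_over_scale[OF N.subspace_tangent N.metric_linear_right[OF g that(1,2)] that(3)]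
      linear_over_add[OF N.subspace_tangent N.metric_linear_left[OF g that(1,2)] that(3)]
      linear_over_add[OF N.subspace_tangent N.metric_linear_right[OF g that(1,2)] that(3)]
    by simp_all
  have expand: "g (\<phi> q) (V q) (W q) = (\<Sum>b\<in>Basis. \<Sum>c\<in>Basis. ?V b q * (?W c q * ?G b c (\<phi> q)))"
    if "q \<in> {q \<in> points M. \<phi> q \<in> dom_of d}" for q
  proof -
    have q: "q \<in> points M" "\<phi> q \<in> dom_of d" using that by auto
    note ET = N.coord_field_tangent[OF d(1) q(2)] and y = phi_points[OF q(1)]
    have "g (\<phi> q) (V q) (W q)
        = g (\<phi> q) (\<Sum>b\<in>Basis. ?V b q *\<^sub>R ?E b (\<phi> q)) (\<Sum>c\<in>Basis. ?W c q *\<^sub>R ?E c (\<phi> q))"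
      using diff_along_expand[OF V q(1) d(1) q(2)] diff_along_expand[OF W q(1) d(1) q(2)] by simp
    also have "\<dots> = (\<Sum>b\<in>Basis. \<Sum>c\<in>Basis. g (\<phi> q) (?V b q *\<^sub>R ?E b (\<phi> q)) (?W c q *\<^sub>R ?E c (\<phi> q)))"
      by (rule N.metric_sum[OF g y]) (intro N.tangent_scale ET)+
    finally show ?thesis by (simp add: sc[OF y] ET N.tangent_scale mult.left_commute)
  qed
  note mV = mdiff_inner[OF diff_along_mdiff[OF V d]] and mW = mdiff_inner[OF diff_along_mdiff[OF W d]]
    and mG = mdiff_comp_phi[OF p d(2) sG]
  have "vderiv M p v (\<lambda>q. g (\<phi> q) (V q) (W q))
      = vderiv M p v (\<lambda>q. \<Sum>b\<in>Basis. \<Sum>c\<in>Basis. ?V b q * (?W c q * ?G b c (\<phi> q)))"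
    by (rule M.vderiv_cong[OF U expand])
  also have "\<dots> = (\<Sum>b\<in>Basis. \<Sum>c\<in>Basis. ?dV b * (?W c p * ?G b c (\<phi> p))
      + ?V b p * (?dW c * ?G b c (\<phi> p) + ?W c p * vderiv N (\<phi> p) ?w (?G b c)))"
    by (simp add: vderiv_sum mdiff_sum M.mdiff_mult[OF p] M.vderiv_mult[OF p] mV mW mG
        vderiv_inner[OF diff_along_mdiff[OF V d]] vderiv_inner[OF diff_along_mdiff[OF W d]]
        vderiv_comp_phi[OF p d(2) sG])
  finally have 1: "vderiv M p v (\<lambda>q. g (\<phi> q) (V q) (W q))
      = (\<Sum>b\<in>Basis. \<Sum>c\<in>Basis. ?dV b * (?W c p * ?G b c (\<phi> p))
      + ?V b p * (?dW c * ?G b c (\<phi> p) + ?W c p * vderiv N (\<phi> p) ?w (?G b c)))" .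
  note ET = N.coord_field_tangent[OF d] and DT = N.D_coord_field_tangent[OF d w]
  note TT = N.tangent_scale N.tangent_add ET DT
  have 2: "g (\<phi> p) (cov p v V) (W p)
      = (\<Sum>b\<in>Basis. \<Sum>c\<in>Basis. g (\<phi> p) (?dV b *\<^sub>R ?E b (\<phi> p) + ?V b p *\<^sub>R ?DE b) (?W c p *\<^sub>R ?E c (\<phi> p)))"
    unfolding cov_expand[OF p V d TV]
    by (subst diff_along_expand[OF W p d]) (rule N.metric_sum[OF g x]; intro TT)
  have 3: "g (\<phi> p) (V p) (cov p v W)
      = (\<Sum>b\<in>Basis. \<Sum>c\<in>Basis. g (\<phi> p) (?V b p *\<^sub>R ?E b (\<phi> p)) (?dW c *\<^sub>R ?E c (\<phi> p) + ?W c p *\<^sub>R ?DE c))"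
    unfolding cov_expand[OF p W d TW]
    by (subst diff_along_expand[OF V p d]) (rule N.metric_sum[OF g x]; intro TT)
  \<comment> \<open>The sums match for each pair b, c: of the two terms of \<open>dG\<close>, the
    one differentiating E_b belongs to the derivative of \<open>V\<close>, the one differentiating
    E_c to that of \<open>W\<close>.\<close>
  show ?thesis
    unfolding 1 2 3 sum.distrib[symmetric]
    by (intro sum.cong refl) (simp add: dG sc[OF x] TT algebra_simps)
qed

end

section \<open>Submanifolds with a normal frame\<close>

locale framed_submanifold = map_to_connection_mfd M N Dt \<phi> + M: connection_mfd M D
  for M :: "('a, 'e::euclidean_space) manifold" and N :: "('b, 'f::euclidean_space) manifold"
    and Dt \<phi> D +
  fixes gt :: "'b \<Rightarrow> ('b, 'f) tvec \<Rightarrow> ('b, 'f) tvec \<Rightarrow> real" and r :: nat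
    and \<nu> :: "nat \<Rightarrow> 'a \<Rightarrow> ('b, 'f) tvec" and h A l
  assumes riem: "riemannian_metric N gt" and lc: "levi_civita N gt Dt"
    and imm: "immersion M N \<phi>" and frame: "normal_frame M N \<phi> gt r \<nu>"
    and gw: "gauss_weingarten M N \<phi> Dt D r \<nu> h A l"
begin

text \<open>Common normal form of the Gauss formula, the Weingarten formula and both formulas
  defining the induced structure. Only the values of \<open>c\<close> on \<open>{1..r}\<close>
  matter.\<close>

definition decomp :: "'a \<Rightarrow> ('a, 'e) tvec \<Rightarrow> (nat \<Rightarrow> real) \<Rightarrow> ('b, 'f) tvec" where
  "decomp p v c = pf p v + (\<Sum>\<alpha>\<in>{1..r}. c \<alpha> *\<^sub>R \<nu> \<alpha> p)"

lemma decomp_add: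
  "p \<in> points M \<Longrightarrow> decomp p v c + decomp p v' c' = decomp p (v + v') (\<lambda>\<alpha>. c \<alpha> + c' \<alpha>)"
  by (simp add: decomp_def linear_add[OF pf_linear] scaleR_left_distrib sum.distrib)

lemma decomp_sum:
  assumes "p \<in> points M"
  shows "(\<Sum>\<alpha>\<in>I. s \<alpha> *\<^sub>R decomp p (w \<alpha>) (k \<alpha>))
    = decomp p (\<Sum>\<alpha>\<in>I. s \<alpha> *\<^sub>R w \<alpha>) (\<lambda>\<beta>. \<Sum>\<alpha>\<in>I. s \<alpha> * k \<alpha> \<beta>)"
  by (simp add: decomp_def scaleR_right_distrib sum.distrib linear_sum[OF pf_linear[OF assms]]
      linear_scale[OF pf_linear[OF assms]] scaleR_sum_right scaleR_sum_left sum.swap[of _ I])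

lemma frame_sum_decomp: "p \<in> points M \<Longrightarrow> (\<Sum>\<alpha>\<in>{1..r}. c \<alpha> *\<^sub>R \<nu> \<alpha> p) = decomp p 0 c"
  by (simp add: decomp_def linear_0[OF pf_linear])

lemma frame_diff: "\<alpha> \<in> {1..r} \<Longrightarrow> p \<in> points M \<Longrightarrow> diff_along M N \<phi> p (\<nu> \<alpha>)"
  using frame vfields_along_diff unfolding normal_frame_def by blast

lemma frame_tangent: "\<alpha> \<in> {1..r} \<Longrightarrow> p \<in> points M \<Longrightarrow> \<nu> \<alpha> p \<in> tangent_space N (\<phi> p)"
  using diff_along_tangent[OF frame_diff] .

lemma decomp_tangent: "p \<in> points M \<Longrightarrow> decomp p v c \<in> tangent_space N (\<phi> p)"
  unfolding decomp_def
  by (intro N.tangent_add N.tangent_sum N.tangent_scale pf_tangent frame_tangent)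

lemma
  assumes "p \<in> points M" "\<alpha> \<in> {1..r}"
  shows metric_pf_frame: "v \<in> tangent_space M p \<Longrightarrow> gt (\<phi> p) (pf p v) (\<nu> \<alpha> p) = 0"
    and metric_frame: "\<beta> \<in> {1..r} \<Longrightarrow> gt (\<phi> p) (\<nu> \<alpha> p) (\<nu> \<beta> p) = (if \<alpha> = \<beta> then 1 else 0)"
  using frame assms unfolding normal_frame_def by blast+

lemma metric_linear:
  assumes "y \<in> points N" "s \<in> tangent_space N y"
  shows "t \<in> tangent_space N y \<Longrightarrow> t' \<in> tangent_space N y \<Longrightarrow> gt y (t + t') s = gt y t s + gt y t' s"
    and "t \<in> tangent_space N y \<Longrightarrow> gt y (a *\<^sub>R t) s = a * gt y t s"
    and "(\<And>i. i \<in> I \<Longrightarrow> f i \<in> tangent_space N y) \<Longrightarrow>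
      gt y (\<Sum>i\<in>I. c i *\<^sub>R f i) s = (\<Sum>i\<in>I. c i * gt y (f i) s)"
  using linear_over_add[OF N.subspace_tangent N.metric_linear_left[OF riem assms]]
    linear_over_scale[OF N.subspace_tangent N.metric_linear_left[OF riem assms]]
    linear_over_sum[OF N.subspace_tangent N.metric_linear_left[OF riem assms], of I f c]
  by simp_all

lemma metric_decomp_frame:
  assumes p: "p \<in> points M" and v: "v \<in> tangent_space M p" and \<beta>: "\<beta> \<in> {1..r}"
  shows "gt (\<phi> p) (decomp p v c) (\<nu> \<beta> p) = c \<beta>"
proof -
  note x = phi_points[OF p] and t = frame_tangent[OF _ p]
  have "gt (\<phi> p) (decomp p v c) (\<nu> \<beta> p)
      = gt (\<phi> p) (pf p v) (\<nu> \<beta> p) + gt (\<phi> p) (\<Sum>\<alpha>\<in>{1..r}. c \<alpha> *\<^sub>R \<nu> \<alpha> p) (\<nu> \<beta> p)"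
    unfolding decomp_def
    by (intro metric_linear(1)[OF x] N.tangent_sum N.tangent_scale t pf_tangent p \<beta>)
  also have "gt (\<phi> p) (\<Sum>\<alpha>\<in>{1..r}. c \<alpha> *\<^sub>R \<nu> \<alpha> p) (\<nu> \<beta> p)
      = (\<Sum>\<alpha>\<in>{1..r}. c \<alpha> * gt (\<phi> p) (\<nu> \<alpha> p) (\<nu> \<beta> p))"
    by (intro metric_linear(3)[OF x] t \<beta>)
  also have "\<dots> = (\<Sum>\<alpha>\<in>{1..r}. if \<alpha> = \<beta> then c \<alpha> else 0)"
    by (intro sum.cong) (simp_all add: metric_frame[OF p _ \<beta>])
  also have "\<dots> = c \<beta>" using \<beta> by (simp add: sum.delta)
  finally show ?thesis using metric_pf_frame[OF p \<beta> v] by simp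
qed

lemma metric_decomp_pf:
  assumes p: "p \<in> points M" and w: "w \<in> tangent_space M p"
  shows "gt (\<phi> p) (decomp p v c) (pf p w) = gt (\<phi> p) (pf p v) (pf p w)"
proof -
  note x = phi_points[OF p] and t = frame_tangent[OF _ p] and pt = pf_tangent[OF p]
  have "gt (\<phi> p) (decomp p v c) (pf p w)
      = gt (\<phi> p) (pf p v) (pf p w) + gt (\<phi> p) (\<Sum>\<alpha>\<in>{1..r}. c \<alpha> *\<^sub>R \<nu> \<alpha> p) (pf p w)"
    unfolding decomp_def by (intro metric_linear(1)[OF x] N.tangent_sum N.tangent_scale t pt)
  also have "gt (\<phi> p) (\<Sum>\<alpha>\<in>{1..r}. c \<alpha> *\<^sub>R \<nu> \<alpha> p) (pf p w)
      = (\<Sum>\<alpha>\<in>{1..r}. c \<alpha> * gt (\<phi> p) (\<nu> \<alpha> p) (pf p w))"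
    by (intro metric_linear(3)[OF x] t pt)
  also have "\<dots> = 0"
    by (intro sum.neutral ballI)
      (simp add: N.metric_sym[OF riem x t pt] metric_pf_frame[OF p _ w])
  finally show ?thesis by simp
qed

text \<open>Pairing with each frame vector recovers its coefficient. Once the normal parts are
  cancelled, the pushforwards agree, and an immersion has an injective pushforward on the tangent
  space.\<close>

lemma decomp_unique:
  assumes p: "p \<in> points M" and v: "v \<in> tangent_space M p" "v' \<in> tangent_space M p"
    and eq: "decomp p v c = decomp p v' c'"
  shows "v = v'" and "\<alpha> \<in> {1..r} \<Longrightarrow> c \<alpha> = c' \<alpha>"
proof -
  show c: "c \<alpha> = c' \<alpha>" if "\<alpha> \<in> {1..r}" for \<alpha>
    using metric_decomp_frame[OF p v(1) that, of c] metric_decomp_frame[OF p v(2) that, of c'] eq by simp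
  have "pf p v = pf p v'" using eq c by (simp add: decomp_def)
  then show "v = v'" using imm p v unfolding immersion_def inj_on_def by blast
qed

section \<open>Gauss and Weingarten formulas and their metric consequences\<close>

lemma gauss:
  assumes "X \<in> vfields M" "Y \<in> vfields M" "p \<in> points M"
  shows "cov p (X p) (\<lambda>q. pf q (Y q)) = decomp p (D p (X p) Y) (\<lambda>\<alpha>. h \<alpha> p (X p) (Y p))"
  using gw assms unfolding gauss_weingarten_def decomp_def by blast

lemma weingarten:
  assumes "X \<in> vfields M" "\<alpha> \<in> {1..r}" "p \<in> points M"
  shows "cov p (X p) (\<nu> \<alpha>) = decomp p (- A \<alpha> p (X p)) (\<lambda>\<beta>. l \<alpha> \<beta> p (X p))"
proof -
  have "cov p (X p) (\<nu> \<alpha>) = - pf p (A \<alpha> p (X p)) + (\<Sum>\<beta>\<in>{1..r}. l \<alpha> \<beta> p (X p) *\<^sub>R \<nu> \<beta> p)"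
    using gw assms unfolding gauss_weingarten_def by blast
  then show ?thesis by (simp add: decomp_def linear_neg[OF pf_linear[OF assms(3)]])
qed

lemma A_tangent:
  assumes "\<alpha> \<in> {1..r}" "p \<in> points M" "v \<in> tangent_space M p"
  shows "A \<alpha> p v \<in> tangent_space M p"
  using gw assms M.tensor11_tangent unfolding gauss_weingarten_def by blast

lemma vfields_tangent: "X \<in> vfields M \<Longrightarrow> p \<in> points M \<Longrightarrow> X p \<in> tangent_space M p"
  by (rule M.vfields_onD(1))

lemma D_vfields_tangent:
  "X \<in> vfields M \<Longrightarrow> Y \<in> vfields M \<Longrightarrow> p \<in> points M \<Longrightarrow> D p (X p) Y \<in> tangent_space M p"
  by (rule M.D_tangent[OF openin_topspace _ _ vfields_tangent])

text \<open>The second product is written with its arguments exchanged, so that both have a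
  \<open>decomp\<close> on the left and can be evaluated by \<open>metric_decomp_frame\<close> and
  \<open>metric_decomp_pf\<close>. The \<open>decomp\<close> form also supplies the tangency that
  \<open>cov_metric\<close> requires.\<close>

lemma cov_metric_vfields:
  assumes "p \<in> points M" "diff_along M N \<phi> p V" "diff_along M N \<phi> p W"
    and "cov p v V = decomp p v1 c1" "cov p v W = decomp p v2 c2"
  shows "vderiv M p v (\<lambda>q. gt (\<phi> q) (V q) (W q))
    = gt (\<phi> p) (decomp p v1 c1) (W p) + gt (\<phi> p) (decomp p v2 c2) (V p)"
  using cov_metric[OF assms(1-3) _ _ riem lc, of v] assms(4,5) decomp_tangent[OF assms(1)]
    N.metric_sym[OF riem phi_points[OF assms(1)] diff_along_tangent[OF assms(2,1)]] assms(1)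
  by simp

lemma vderiv_constant:
  assumes "p \<in> points M" "\<And>q. q \<in> points M \<Longrightarrow> f q = c"
  shows "vderiv M p v f = 0"
  using M.vderiv_cong[OF assms(1) openin_topspace, of f "\<lambda>_. c"] assms(2) by (simp add: vderiv_const)

text \<open>Differentiate the constant g(\<nu>_\<alpha>, \<nu>_\<beta>) along \<open>X\<close>;
  pairing each derivative with the other frame vector leaves one \<open>l\<close> term
  apiece.\<close>

lemma normal_connection_antisym:
  assumes X: "X \<in> vfields M" and \<alpha>: "\<alpha> \<in> {1..r}" and \<beta>: "\<beta> \<in> {1..r}" and p: "p \<in> points M"
  shows "l \<alpha> \<beta> p (X p) = - l \<beta> \<alpha> p (X p)"
proof -
  note t = M.tangent_neg[OF A_tangent[OF _ p vfields_tangent[OF X p]]]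
  have "vderiv M p (X p) (\<lambda>q. gt (\<phi> q) (\<nu> \<alpha> q) (\<nu> \<beta> q)) = 0"
    by (rule vderiv_constant[OF p metric_frame[OF _ \<alpha> \<beta>]])
  then show ?thesis
    using cov_metric_vfields[OF p frame_diff[OF \<alpha> p] frame_diff[OF \<beta> p] weingarten[OF X \<alpha> p]
        weingarten[OF X \<beta> p]] metric_decomp_frame[OF p t[OF \<alpha>] \<beta>] metric_decomp_frame[OF p t[OF \<beta>] \<alpha>]
    by simp
qed

text \<open>Differentiate g(Y, \<nu>_\<alpha>) = 0 along \<open>X\<close>: the Gauss formula
  contributes \<open>h\<close>, the Weingarten formula minus the product with
  \<open>A\<close>.\<close>

lemma shape_operator:
  assumes X: "X \<in> vfields M" and Y: "Y \<in> vfields M" and \<alpha>: "\<alpha> \<in> {1..r}" and p: "p \<in> points M"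
  shows "h \<alpha> p (X p) (Y p) = gt (\<phi> p) (pf p (A \<alpha> p (X p))) (pf p (Y p))"
proof -
  note x = phi_points[OF p]
  have "vderiv M p (X p) (\<lambda>q. gt (\<phi> q) (pf q (Y q)) (\<nu> \<alpha> q)) = 0"
    by (rule vderiv_constant[OF p metric_pf_frame[OF _ \<alpha> vfields_tangent[OF Y]]])
  then have "h \<alpha> p (X p) (Y p) + gt (\<phi> p) (pf p (- A \<alpha> p (X p))) (pf p (Y p)) = 0"
    using cov_metric_vfields[OF p pf_diff_along[OF Y p] frame_diff[OF \<alpha> p] gauss[OF X Y p]
        weingarten[OF X \<alpha> p]] metric_decomp_frame[OF p D_vfields_tangent[OF X Y p] \<alpha>]
      metric_decomp_pf[OF p vfields_tangent[OF Y p]] by simp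
  then show ?thesis
    using metric_linear(2)[OF x pf_tangent[OF p] pf_tangent[OF p], of "-1"]
    by (simp add: linear_neg[OF pf_linear[OF p]])
qed

text \<open>Gauss formula for the tangential part, Leibniz rule and Weingarten formula for the frame
  part. It serves twice: with coefficients u_\<alpha>(Y) for the image of a tangent field, and with
  a_\<alpha>\<beta> for the image of a frame field.\<close>

lemma cov_decomp:
  assumes X: "X \<in> vfields M" and Y: "Y \<in> vfields M" and p: "p \<in> points M"
    and f: "\<And>\<alpha>. \<alpha> \<in> {1..r} \<Longrightarrow> smooth_fun_on M (points M) (f \<alpha>)"
  shows "cov p (X p) (\<lambda>q. decomp q (Y q) (\<lambda>\<alpha>. f \<alpha> q))
    = decomp p (D p (X p) Y - (\<Sum>\<alpha>\<in>{1..r}. f \<alpha> p *\<^sub>R A \<alpha> p (X p)))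
        (\<lambda>\<beta>. h \<beta> p (X p) (Y p) + vderiv M p (X p) (f \<beta>) + (\<Sum>\<alpha>\<in>{1..r}. f \<alpha> p * l \<alpha> \<beta> p (X p)))"
proof -
  have mf: "mdiff M p (f \<alpha>)" if "\<alpha> \<in> {1..r}" for \<alpha>
    by (rule M.smooth_fun_on_imp_mdiff[OF f[OF that] p p])
  have "cov p (X p) (\<lambda>q. decomp q (Y q) (\<lambda>\<alpha>. f \<alpha> q))
      = cov p (X p) (\<lambda>q. pf q (Y q)) + cov p (X p) (\<lambda>q. \<Sum>\<alpha>\<in>{1..r}. f \<alpha> q *\<^sub>R \<nu> \<alpha> q)"
    unfolding decomp_def
    by (intro cov_add p pf_diff_along Y diff_along_sum diff_along_scaleR frame_diff mf)
  also have "cov p (X p) (\<lambda>q. \<Sum>\<alpha>\<in>{1..r}. f \<alpha> q *\<^sub>R \<nu> \<alpha> q)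
      = (\<Sum>\<alpha>\<in>{1..r}. vderiv M p (X p) (f \<alpha>) *\<^sub>R \<nu> \<alpha> p + f \<alpha> p *\<^sub>R cov p (X p) (\<nu> \<alpha>))"
    by (rule cov_sum[OF p frame_diff[OF _ p] mf])
  also have "\<dots> = decomp p 0 (\<lambda>\<alpha>. vderiv M p (X p) (f \<alpha>))
      + (\<Sum>\<alpha>\<in>{1..r}. f \<alpha> p *\<^sub>R decomp p (- A \<alpha> p (X p)) (\<lambda>\<beta>. l \<alpha> \<beta> p (X p)))"
    unfolding sum.distrib frame_sum_decomp[OF p] by (simp add: weingarten[OF X _ p])
  finally show ?thesis
    by (simp add: gauss[OF X Y p] decomp_sum[OF p] decomp_add[OF p] sum_negf add.assoc)
qed

end

theorem theorem2p1:
  fixes M :: "('a, 'e::euclidean_space) manifold"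
    and Mt :: "('b, 'f::euclidean_space) manifold"
    and \<iota> :: "'a \<Rightarrow> 'b"
    and gt :: "'b \<Rightarrow> ('b, 'f) tvec \<Rightarrow> ('b, 'f) tvec \<Rightarrow> real"
    and Pt :: "'b \<Rightarrow> ('b, 'f) tvec \<Rightarrow> ('b, 'f) tvec"
    and Dt :: "'b \<Rightarrow> ('b, 'f) tvec \<Rightarrow> ('b \<Rightarrow> ('b, 'f) tvec) \<Rightarrow> ('b, 'f) tvec"
    and g :: "'a \<Rightarrow> ('a, 'e) tvec \<Rightarrow> ('a, 'e) tvec \<Rightarrow> real"
    and D :: "'a \<Rightarrow> ('a, 'e) tvec \<Rightarrow> ('a \<Rightarrow> ('a, 'e) tvec) \<Rightarrow> ('a, 'e) tvec"
    and P :: "'a \<Rightarrow> ('a, 'e) tvec \<Rightarrow> ('a, 'e) tvec"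
    and u :: "nat \<Rightarrow> 'a \<Rightarrow> ('a, 'e) tvec \<Rightarrow> real"
    and \<xi> :: "nat \<Rightarrow> 'a \<Rightarrow> ('a, 'e) tvec"
    and a :: "nat \<Rightarrow> nat \<Rightarrow> 'a \<Rightarrow> real"
    and \<nu> :: "nat \<Rightarrow> 'a \<Rightarrow> ('b, 'f) tvec"
    and h :: "nat \<Rightarrow> 'a \<Rightarrow> ('a, 'e) tvec \<Rightarrow> ('a, 'e) tvec \<Rightarrow> real"
    and A :: "nat \<Rightarrow> 'a \<Rightarrow> ('a, 'e) tvec \<Rightarrow> ('a, 'e) tvec"
    and l :: "nat \<Rightarrow> nat \<Rightarrow> 'a \<Rightarrow> ('a, 'e) tvec \<Rightarrow> real"
    and \<epsilon> :: real and n r :: nat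
  assumes eps: "\<epsilon> \<in> {1, -1}"
    and dims: "DIM('e) = n" "DIM('f) = n + r"
    and ambient: "smooth_manifold Mt" "riemannian_metric Mt gt" "levi_civita Mt gt Dt"
    and compatible: "tensor11 Mt Pt"
      "\<And>x v. x \<in> points Mt \<Longrightarrow> v \<in> tangent_space Mt x \<Longrightarrow> Pt x (Pt x v) = \<epsilon> *\<^sub>R v"
      "\<And>x v w. x \<in> points Mt \<Longrightarrow> v \<in> tangent_space Mt x \<Longrightarrow> w \<in> tangent_space Mt x \<Longrightarrow>
         gt x (Pt x v) (Pt x w) = gt x v w"
    and parallel: "parallel11 Mt Dt Pt"
    and submanifold: "smooth_manifold M" "immersion M Mt \<iota>"
    and induced_metric: "g = pullback_metric M Mt \<iota> gt" "levi_civita M g D"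
    and frame: "normal_frame M Mt \<iota> gt r \<nu>"
    and induced: "induced_structure M Mt \<iota> Pt \<epsilon> r \<nu> P u \<xi> a"
    and second_ff: "gauss_weingarten M Mt \<iota> Dt D r \<nu> h A l"
  shows
    "(\<forall>X\<in>vfields M. \<forall>Y\<in>vfields M. \<forall>p\<in>points M.
       cov_tensor11 D P X Y p =
         \<epsilon> *\<^sub>R (\<Sum>\<alpha>\<in>{1..r}. h \<alpha> p (X p) (Y p) *\<^sub>R \<xi> \<alpha> p)
         + (\<Sum>\<alpha>\<in>{1..r}. u \<alpha> p (Y p) *\<^sub>R A \<alpha> p (X p)))
     \<and>
     (\<forall>X\<in>vfields M. \<forall>Y\<in>vfields M. \<forall>\<alpha>\<in>{1..r}. \<forall>p\<in>points M.
       cov_form M D (u \<alpha>) X Y p =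
         - h \<alpha> p (X p) (P p (Y p))
         + (\<Sum>\<beta>\<in>{1..r}. u \<beta> p (Y p) * l \<alpha> \<beta> p (X p))
         + (\<Sum>\<beta>\<in>{1..r}. h \<beta> p (X p) (Y p) * a \<beta> \<alpha> p))
     \<and>
     (\<forall>X\<in>vfields M. \<forall>\<alpha>\<in>{1..r}. \<forall>p\<in>points M.
       D p (X p) (\<xi> \<alpha>) =
         - (\<epsilon> *\<^sub>R P p (A \<alpha> p (X p)))
         + \<epsilon> *\<^sub>R (\<Sum>\<beta>\<in>{1..r}. a \<alpha> \<beta> p *\<^sub>R A \<beta> p (X p))
         + (\<Sum>\<beta>\<in>{1..r}. l \<alpha> \<beta> p (X p) *\<^sub>R \<xi> \<beta> p))
     \<and>
     (\<forall>X\<in>vfields M. \<forall>\<alpha>\<in>{1..r}. \<forall>\<beta>\<in>{1..r}. \<forall>p\<in>points M.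
       vderiv M p (X p) (a \<alpha> \<beta>) =
         - (\<epsilon> * u \<alpha> p (A \<beta> p (X p))) - u \<beta> p (A \<alpha> p (X p))
         + (\<Sum>\<gamma>\<in>{1..r}. l \<alpha> \<gamma> p (X p) * a \<gamma> \<beta> p + l \<beta> \<gamma> p (X p) * a \<alpha> \<gamma> p))"
proof -
  interpret framed_submanifold M Mt Dt \<iota> D gt r \<nu> h A l
    using ambient submanifold induced_metric frame second_ff
    by unfold_locales (simp_all add: levi_civita_def immersion_def)

  \<comment> \<open>The ambient tensor field in the splitting into tangential part and frame
    coefficients\<close>
  have \<epsilon>2: "\<epsilon> * \<epsilon> = 1" using eps by auto
  have PT: "tensor11 M P" and uF: "\<And>\<alpha>. \<alpha> \<in> {1..r} \<Longrightarrow> one_form M (u \<alpha>)"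
    and \<xi>V: "\<And>\<alpha>. \<alpha> \<in> {1..r} \<Longrightarrow> \<xi> \<alpha> \<in> vfields M"
    and aS: "\<And>\<alpha> \<beta>. \<alpha> \<in> {1..r} \<Longrightarrow> \<beta> \<in> {1..r} \<Longrightarrow> smooth_fun_on M (points M) (a \<alpha> \<beta>)"
    using induced unfolding induced_structure_def by auto
  have P_pf: "Pt (\<iota> p) (pf p v) = decomp p (P p v) (\<lambda>\<alpha>. u \<alpha> p v)"
    if "p \<in> points M" "v \<in> tangent_space M p" for p v
    using induced that unfolding induced_structure_def decomp_def by blast
  have P_frame: "Pt (\<iota> p) (\<nu> \<alpha> p) = decomp p (\<epsilon> *\<^sub>R \<xi> \<alpha> p) (\<lambda>\<beta>. a \<alpha> \<beta> p)"
    if "p \<in> points M" "\<alpha> \<in> {1..r}" for p \<alpha>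
    using induced that linear_scale[OF pf_linear[OF that(1)]]
    unfolding induced_structure_def decomp_def by simp
  have P_tangent: "P p v \<in> tangent_space M p" if "p \<in> points M" "v \<in> tangent_space M p" for p v
    using M.tensor11_tangent[OF PT that] .
  \<comment> \<open>The block form of \<open>Pt\<close> with respect to the splitting: tangential
    input goes through \<open>P\<close> and \<open>u\<close>, frame coefficients through \<epsilon>
    \<xi> and \<open>a\<close>.\<close>
  have P_decomp: "Pt (\<iota> p) (decomp p v c) = decomp p (P p v + \<epsilon> *\<^sub>R (\<Sum>\<alpha>\<in>{1..r}. c \<alpha> *\<^sub>R \<xi> \<alpha> p))
      (\<lambda>\<beta>. u \<beta> p v + (\<Sum>\<alpha>\<in>{1..r}. c \<alpha> * a \<alpha> \<beta> p))"
    if p: "p \<in> points M" and v: "v \<in> tangent_space M p" for p v c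
  proof -
    note lin = N.tensor11_linear_over[OF compatible(1) phi_points[OF p]]
    have "Pt (\<iota> p) (decomp p v c)
        = Pt (\<iota> p) (pf p v) + Pt (\<iota> p) (\<Sum>\<alpha>\<in>{1..r}. c \<alpha> *\<^sub>R \<nu> \<alpha> p)"
      unfolding decomp_def
      by (intro linear_over_add[OF N.subspace_tangent lin] pf_tangent p N.tangent_sum
          N.tangent_scale frame_tangent)
    also have "Pt (\<iota> p) (\<Sum>\<alpha>\<in>{1..r}. c \<alpha> *\<^sub>R \<nu> \<alpha> p) = (\<Sum>\<alpha>\<in>{1..r}. c \<alpha> *\<^sub>R Pt (\<iota> p) (\<nu> \<alpha> p))"
      by (rule linear_over_sum[OF N.subspace_tangent lin frame_tangent[OF _ p]])
    also have "\<dots> = (\<Sum>\<alpha>\<in>{1..r}. c \<alpha> *\<^sub>R decomp p (\<epsilon> *\<^sub>R \<xi> \<alpha> p) (\<lambda>\<beta>. a \<alpha> \<beta> p))"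
      by (simp add: P_frame[OF p])
    finally show ?thesis
      by (simp add: P_pf[OF p v] decomp_sum[OF p] decomp_add[OF p] scaleR_sum_right mult.commute)
  qed
  \<comment> \<open>Isometry moves a second \<open>Pt\<close> onto both arguments. One \<epsilon>
    comes from the square of \<open>Pt\<close>, the other from the tangential part \<epsilon>
    \<xi>_\<alpha> of Pt \<nu>_\<alpha>, and their product is 1.\<close>
  have u_eq: "u \<alpha> p v = gt (\<iota> p) (pf p v) (pf p (\<xi> \<alpha> p))"
    if \<alpha>: "\<alpha> \<in> {1..r}" and p: "p \<in> points M" and v: "v \<in> tangent_space M p" for \<alpha> p v
  proof -
    note x = phi_points[OF p] and pt = pf_tangent[OF p] and ft = frame_tangent[OF \<alpha> p]
    note t\<xi> = vfields_tangent[OF \<xi>V[OF \<alpha>] p]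
    note Pt_tangent = N.tensor11_tangent[OF compatible(1) x]
    have "u \<alpha> p v = gt (\<iota> p) (Pt (\<iota> p) (pf p v)) (\<nu> \<alpha> p)"
      by (simp add: P_pf[OF p v] metric_decomp_frame[OF p P_tangent[OF p v] \<alpha>])
    also have "\<dots> = gt (\<iota> p) (\<epsilon> *\<^sub>R pf p v) (Pt (\<iota> p) (\<nu> \<alpha> p))"
      using compatible(3)[OF x Pt_tangent[OF pt] ft] compatible(2)[OF x pt] by simp
    also have "\<dots> = \<epsilon> * gt (\<iota> p) (decomp p (\<epsilon> *\<^sub>R \<xi> \<alpha> p) (\<lambda>\<beta>. a \<alpha> \<beta> p)) (pf p v)"
      unfolding P_frame[OF p \<alpha>]
      by (simp add: metric_linear(2)[OF x decomp_tangent[OF p] pt]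
          N.metric_sym[OF riem x pt decomp_tangent[OF p]])
    also have "\<dots> = gt (\<iota> p) (pf p (\<xi> \<alpha> p)) (pf p v)"
      by (simp add: metric_decomp_pf[OF p v] linear_scale[OF pf_linear[OF p]]
          metric_linear(2)[OF x pt pt] \<epsilon>2 mult.assoc[symmetric])
    finally show ?thesis by (simp add: N.metric_sym[OF riem x pt pt])
  qed
  \<comment> \<open>Both sides are the product of A_\<beta> X with \<xi>_\<alpha>, by
    \<open>shape_operator\<close> and \<open>u_eq\<close>.\<close>
  have u_A: "h \<beta> p (X p) (\<xi> \<alpha> p) = u \<alpha> p (A \<beta> p (X p))"
    if "X \<in> vfields M" "\<alpha> \<in> {1..r}" "\<beta> \<in> {1..r}" "p \<in> points M" for X \<alpha> \<beta> p
    using that shape_operator[OF that(1) \<xi>V[OF that(2)] that(3,4)]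
      u_eq[OF that(2,4) A_tangent[OF that(3,4) vfields_tangent[OF that(1,4)]]] by simp

  have tan: "D p (X p) (\<lambda>q. P q (Y q)) - (\<Sum>\<alpha>\<in>{1..r}. u \<alpha> p (Y p) *\<^sub>R A \<alpha> p (X p))
        = P p (D p (X p) Y) + \<epsilon> *\<^sub>R (\<Sum>\<alpha>\<in>{1..r}. h \<alpha> p (X p) (Y p) *\<^sub>R \<xi> \<alpha> p)" (is ?t)
    and nor: "\<beta> \<in> {1..r} \<Longrightarrow> h \<beta> p (X p) (P p (Y p)) + vderiv M p (X p) (\<lambda>q. u \<beta> q (Y q))
          + (\<Sum>\<alpha>\<in>{1..r}. u \<alpha> p (Y p) * l \<alpha> \<beta> p (X p))
        = u \<beta> p (D p (X p) Y) + (\<Sum>\<alpha>\<in>{1..r}. h \<alpha> p (X p) (Y p) * a \<alpha> \<beta> p)"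
    if X: "X \<in> vfields M" and Y: "Y \<in> vfields M" and p: "p \<in> points M" for X Y p \<beta>
  proof -
    have PY: "(\<lambda>q. P q (Y q)) \<in> vfields M"
      by (rule M.tensor11_vfields[OF PT openin_topspace Y])
    have uY: "smooth_fun_on M (points M) (\<lambda>q. u \<alpha> q (Y q))" if "\<alpha> \<in> {1..r}" for \<alpha>
      using uF[OF that] Y unfolding one_form_def by blast
    \<comment> \<open>Two evaluations of one vector: decompose \<open>Pt Y\<close> and differentiate
      with \<open>cov_decomp\<close>, or differentiate \<open>Y\<close> by the Gauss formula and
      decompose with \<open>P_decomp\<close>.\<close>
    have "cov p (X p) (\<lambda>q. decomp q (P q (Y q)) (\<lambda>\<alpha>. u \<alpha> q (Y q)))
        = cov p (X p) (\<lambda>q. Pt (\<iota> q) (pf q (Y q)))"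
      by (rule cov_cong[OF p]) (simp add: P_pf vfields_tangent[OF Y])
    also have "\<dots> = Pt (\<iota> p) (cov p (X p) (\<lambda>q. pf q (Y q)))"
      by (rule cov_parallel[OF p pf_diff_along[OF Y p] _ compatible(1) parallel])
        (simp add: gauss[OF X Y p] decomp_tangent[OF p])
    finally have eq: "decomp p (D p (X p) (\<lambda>q. P q (Y q)) - (\<Sum>\<alpha>\<in>{1..r}. u \<alpha> p (Y p) *\<^sub>R A \<alpha> p (X p)))
        (\<lambda>\<beta>. h \<beta> p (X p) (P p (Y p)) + vderiv M p (X p) (\<lambda>q. u \<beta> q (Y q))
          + (\<Sum>\<alpha>\<in>{1..r}. u \<alpha> p (Y p) * l \<alpha> \<beta> p (X p)))
      = decomp p (P p (D p (X p) Y) + \<epsilon> *\<^sub>R (\<Sum>\<alpha>\<in>{1..r}. h \<alpha> p (X p) (Y p) *\<^sub>R \<xi> \<alpha> p))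
        (\<lambda>\<beta>. u \<beta> p (D p (X p) Y) + (\<Sum>\<alpha>\<in>{1..r}. h \<alpha> p (X p) (Y p) * a \<alpha> \<beta> p))"
      by (simp only: cov_decomp[OF X PY p, of "\<lambda>\<alpha> q. u \<alpha> q (Y q)"] uY gauss[OF X Y p]
          P_decomp[OF p D_vfields_tangent[OF X Y p]])
    have t1: "D p (X p) (\<lambda>q. P q (Y q)) - (\<Sum>\<alpha>\<in>{1..r}. u \<alpha> p (Y p) *\<^sub>R A \<alpha> p (X p)) \<in> tangent_space M p"
      by (intro subspace_diff[OF M.subspace_tangent] M.tangent_sum M.tangent_scale A_tangent
          D_vfields_tangent X PY p vfields_tangent)
    have t2: "P p (D p (X p) Y) + \<epsilon> *\<^sub>R (\<Sum>\<alpha>\<in>{1..r}. h \<alpha> p (X p) (Y p) *\<^sub>R \<xi> \<alpha> p) \<in> tangent_space M p"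
      by (intro M.tangent_add M.tangent_sum M.tangent_scale P_tangent
          D_vfields_tangent X Y p vfields_tangent \<xi>V)
    show ?t by (rule decomp_unique(1)[OF p t1 t2 eq])
    show "\<beta> \<in> {1..r} \<Longrightarrow> h \<beta> p (X p) (P p (Y p)) + vderiv M p (X p) (\<lambda>q. u \<beta> q (Y q))
          + (\<Sum>\<alpha>\<in>{1..r}. u \<alpha> p (Y p) * l \<alpha> \<beta> p (X p))
        = u \<beta> p (D p (X p) Y) + (\<Sum>\<alpha>\<in>{1..r}. h \<alpha> p (X p) (Y p) * a \<alpha> \<beta> p)"
      by (rule decomp_unique(2)[OF p t1 t2 eq])
  qed

  have tan_frame: "\<epsilon> *\<^sub>R D p (X p) (\<xi> \<alpha>) - (\<Sum>\<beta>\<in>{1..r}. a \<alpha> \<beta> p *\<^sub>R A \<beta> p (X p))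
        = - P p (A \<alpha> p (X p)) + \<epsilon> *\<^sub>R (\<Sum>\<beta>\<in>{1..r}. l \<alpha> \<beta> p (X p) *\<^sub>R \<xi> \<beta> p)" (is ?t)
    and nor_frame: "\<beta> \<in> {1..r} \<Longrightarrow> \<epsilon> * h \<beta> p (X p) (\<xi> \<alpha> p) + vderiv M p (X p) (a \<alpha> \<beta>)
          + (\<Sum>\<gamma>\<in>{1..r}. a \<alpha> \<gamma> p * l \<gamma> \<beta> p (X p))
        = - u \<beta> p (A \<alpha> p (X p)) + (\<Sum>\<gamma>\<in>{1..r}. l \<alpha> \<gamma> p (X p) * a \<gamma> \<beta> p)"
    if X: "X \<in> vfields M" and \<alpha>: "\<alpha> \<in> {1..r}" and p: "p \<in> points M" for X \<alpha> p \<beta>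
  proof -
    note Xt = vfields_tangent[OF X p] and \<xi>t = vfields_tangent[OF \<xi>V[OF \<alpha>] p]
    note At = A_tangent[OF \<alpha> p Xt]
    \<comment> \<open>The tangential part of Pt \<nu>_\<alpha> is \<epsilon> \<xi>_\<alpha>, so
      \<open>cov_decomp\<close> is applied to this field; the constant \<epsilon> is pulled out of
      \<open>D\<close> and \<open>h\<close> afterwards.\<close>
    have \<epsilon>\<xi>: "(\<lambda>q. \<epsilon> *\<^sub>R \<xi> \<alpha> q) \<in> vfields M"
      by (rule M.vfields_on_scaleR[OF openin_topspace M.smooth_fun_on_const \<xi>V[OF \<alpha>]])
    have D\<epsilon>\<xi>: "D p (X p) (\<lambda>q. \<epsilon> *\<^sub>R \<xi> \<alpha> q) = \<epsilon> *\<^sub>R D p (X p) (\<xi> \<alpha>)"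
      using M.D_scaleR[OF openin_topspace \<xi>V[OF \<alpha>] p M.smooth_fun_on_const[of _ \<epsilon>] Xt]
      by (simp add: vderiv_const)
    have h\<epsilon>: "h \<beta> p (X p) (\<epsilon> *\<^sub>R \<xi> \<alpha> p) = \<epsilon> * h \<beta> p (X p) (\<xi> \<alpha> p)" if "\<beta> \<in> {1..r}" for \<beta>
    proof -
      have "linear_over (tangent_space M p) (h \<beta> p (X p))"
        using second_ff that p Xt unfolding gauss_weingarten_def tensor02_def by blast
      from linear_over_scale[OF M.subspace_tangent this \<xi>t] show ?thesis by simp
    qed
    have PA: "P p (- A \<alpha> p (X p)) = - P p (A \<alpha> p (X p))"
      by (rule linear_over_minus[OF M.subspace_tangent M.tensor11_linear_over[OF PT p] At])
    have uA: "u \<beta> p (- A \<alpha> p (X p)) = - u \<beta> p (A \<alpha> p (X p))" if "\<beta> \<in> {1..r}" for \<beta>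
      using linear_over_minus[OF M.subspace_tangent _ At] uF[OF that] p unfolding one_form_def by blast
    have "cov p (X p) (\<lambda>q. decomp q (\<epsilon> *\<^sub>R \<xi> \<alpha> q) (\<lambda>\<beta>. a \<alpha> \<beta> q))
        = cov p (X p) (\<lambda>q. Pt (\<iota> q) (\<nu> \<alpha> q))"
      by (rule cov_cong[OF p]) (simp only: P_frame[OF _ \<alpha>])
    also have "\<dots> = Pt (\<iota> p) (cov p (X p) (\<nu> \<alpha>))"
      by (rule cov_parallel[OF p frame_diff[OF \<alpha> p] _ compatible(1) parallel])
        (simp add: weingarten[OF X \<alpha> p] decomp_tangent[OF p])
    finally have eq: "decomp p (D p (X p) (\<lambda>q. \<epsilon> *\<^sub>R \<xi> \<alpha> q) - (\<Sum>\<beta>\<in>{1..r}. a \<alpha> \<beta> p *\<^sub>R A \<beta> p (X p)))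
        (\<lambda>\<beta>. h \<beta> p (X p) (\<epsilon> *\<^sub>R \<xi> \<alpha> p) + vderiv M p (X p) (a \<alpha> \<beta>)
          + (\<Sum>\<gamma>\<in>{1..r}. a \<alpha> \<gamma> p * l \<gamma> \<beta> p (X p)))
      = decomp p (P p (- A \<alpha> p (X p)) + \<epsilon> *\<^sub>R (\<Sum>\<beta>\<in>{1..r}. l \<alpha> \<beta> p (X p) *\<^sub>R \<xi> \<beta> p))
        (\<lambda>\<beta>. u \<beta> p (- A \<alpha> p (X p)) + (\<Sum>\<gamma>\<in>{1..r}. l \<alpha> \<gamma> p (X p) * a \<gamma> \<beta> p))"
      by (simp only: cov_decomp[OF X \<epsilon>\<xi> p, of "a \<alpha>"] aS[OF \<alpha>] weingarten[OF X \<alpha> p]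
          P_decomp[OF p M.tangent_neg[OF At]])
    have t1: "D p (X p) (\<lambda>q. \<epsilon> *\<^sub>R \<xi> \<alpha> q) - (\<Sum>\<beta>\<in>{1..r}. a \<alpha> \<beta> p *\<^sub>R A \<beta> p (X p)) \<in> tangent_space M p"
      by (intro subspace_diff[OF M.subspace_tangent] M.tangent_sum M.tangent_scale A_tangent
          D_vfields_tangent X \<epsilon>\<xi> p vfields_tangent)
    have t2: "P p (- A \<alpha> p (X p)) + \<epsilon> *\<^sub>R (\<Sum>\<beta>\<in>{1..r}. l \<alpha> \<beta> p (X p) *\<^sub>R \<xi> \<beta> p) \<in> tangent_space M p"
      by (intro M.tangent_add M.tangent_sum M.tangent_scale P_tangent M.tangent_neg At p
          vfields_tangent \<xi>V)
    show ?t using decomp_unique(1)[OF p t1 t2 eq] unfolding PA D\<epsilon>\<xi> .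
    show "\<epsilon> * h \<beta> p (X p) (\<xi> \<alpha> p) + vderiv M p (X p) (a \<alpha> \<beta>)
          + (\<Sum>\<gamma>\<in>{1..r}. a \<alpha> \<gamma> p * l \<gamma> \<beta> p (X p))
        = - u \<beta> p (A \<alpha> p (X p)) + (\<Sum>\<gamma>\<in>{1..r}. l \<alpha> \<gamma> p (X p) * a \<gamma> \<beta> p)" if "\<beta> \<in> {1..r}"
      using decomp_unique(2)[OF p t1 t2 eq that] unfolding h\<epsilon>[OF that] uA[OF that] .
  qed

  \<comment> \<open>Differentiating the frame yields \<open>l\<close> with the free index second,
    while the claims have it first; antisymmetry reverses the order at the cost of a sign.\<close>
  have l_sum: "(\<Sum>\<gamma>\<in>{1..r}. c \<gamma> * l \<gamma> \<beta> p (X p)) = - (\<Sum>\<gamma>\<in>{1..r}. c \<gamma> * l \<beta> \<gamma> p (X p))"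
    if "X \<in> vfields M" "\<beta> \<in> {1..r}" "p \<in> points M" for X \<beta> p and c :: "nat \<Rightarrow> real"
    unfolding sum_negf[symmetric]
    by (intro sum.cong refl) (subst normal_connection_antisym[OF that(1) _ that(2,3)], simp_all)

  show ?thesis
  proof (intro conjI ballI)
    fix X Y p assume X: "X \<in> vfields M" and Y: "Y \<in> vfields M" and p: "p \<in> points M"
    show "cov_tensor11 D P X Y p = \<epsilon> *\<^sub>R (\<Sum>\<alpha>\<in>{1..r}. h \<alpha> p (X p) (Y p) *\<^sub>R \<xi> \<alpha> p)
         + (\<Sum>\<alpha>\<in>{1..r}. u \<alpha> p (Y p) *\<^sub>R A \<alpha> p (X p))"
      using tan[OF X Y p] unfolding cov_tensor11_def by (simp add: algebra_simps)
  next
    fix X Y \<alpha> p assume X: "X \<in> vfields M" and Y: "Y \<in> vfields M" and \<alpha>: "\<alpha> \<in> {1..r}"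
      and p: "p \<in> points M"
    show "cov_form M D (u \<alpha>) X Y p = - h \<alpha> p (X p) (P p (Y p))
         + (\<Sum>\<beta>\<in>{1..r}. u \<beta> p (Y p) * l \<alpha> \<beta> p (X p))
         + (\<Sum>\<beta>\<in>{1..r}. h \<beta> p (X p) (Y p) * a \<beta> \<alpha> p)"
      using nor[OF X Y p \<alpha>] l_sum[OF X \<alpha> p, of "\<lambda>\<beta>. u \<beta> p (Y p)"] unfolding cov_form_def by linarith
  next
    fix X \<alpha> p assume X: "X \<in> vfields M" and \<alpha>: "\<alpha> \<in> {1..r}" and p: "p \<in> points M"
    \<comment> \<open>\<open>tan_frame\<close> determines \<epsilon> times the derivative of
      \<xi>_\<alpha>; a second multiplication by \<epsilon> isolates the derivative and cancels the
      \<epsilon> in front of the \<open>l\<close> terms.\<close>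
    have "D p (X p) (\<xi> \<alpha>) = \<epsilon> *\<^sub>R (\<epsilon> *\<^sub>R D p (X p) (\<xi> \<alpha>))" by (simp add: \<epsilon>2)
    also have "\<epsilon> *\<^sub>R D p (X p) (\<xi> \<alpha>) = - P p (A \<alpha> p (X p))
        + \<epsilon> *\<^sub>R (\<Sum>\<beta>\<in>{1..r}. l \<alpha> \<beta> p (X p) *\<^sub>R \<xi> \<beta> p) + (\<Sum>\<beta>\<in>{1..r}. a \<alpha> \<beta> p *\<^sub>R A \<beta> p (X p))"
      using tan_frame[OF X \<alpha> p] by (simp add: diff_eq_eq)
    finally show "D p (X p) (\<xi> \<alpha>) = - (\<epsilon> *\<^sub>R P p (A \<alpha> p (X p)))
         + \<epsilon> *\<^sub>R (\<Sum>\<beta>\<in>{1..r}. a \<alpha> \<beta> p *\<^sub>R A \<beta> p (X p))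
         + (\<Sum>\<beta>\<in>{1..r}. l \<alpha> \<beta> p (X p) *\<^sub>R \<xi> \<beta> p)"
      by (simp add: scaleR_right_distrib scaleR_right_diff_distrib \<epsilon>2 add_ac)
  next
    fix X \<alpha> \<beta> p assume X: "X \<in> vfields M" and \<alpha>: "\<alpha> \<in> {1..r}" and \<beta>: "\<beta> \<in> {1..r}"
      and p: "p \<in> points M"
    show "vderiv M p (X p) (a \<alpha> \<beta>) = - (\<epsilon> * u \<alpha> p (A \<beta> p (X p))) - u \<beta> p (A \<alpha> p (X p))
         + (\<Sum>\<gamma>\<in>{1..r}. l \<alpha> \<gamma> p (X p) * a \<gamma> \<beta> p + l \<beta> \<gamma> p (X p) * a \<alpha> \<gamma> p)"
      \<comment> \<open>\<open>u_A\<close> replaces h_\<beta>(X, \<xi>_\<alpha>) by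
        u_\<alpha>(A_\<beta> X), the origin of the asymmetric factor \<epsilon>: the other term
        comes from \<open>P_decomp\<close> applied to -A_\<alpha> X and carries none.\<close>
      using nor_frame[OF X \<alpha> p \<beta>] l_sum[OF X \<beta> p, of "\<lambda>\<gamma>. a \<alpha> \<gamma> p"] u_A[OF X \<alpha> \<beta> p]
      by (simp add: sum.distrib mult.commute[of "l \<beta> _ _ _"])
  qed
qed

end
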